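(* Let $\lambda>0$ and let $Q$ be the continuous-time Markov chain on $\mathbb N^N$ of interference-coupled queues with arrival rate $\lambda$ (generator $\mathcal L$ given in the context), and let $\mu^*=B\log_2\bigl(1+\frac{1}{1+\xi_N}\bigr)$. If $\lambda>\mu^*$, then $Q$ is transient. If $\lambda<\mu^*$, then $Q$ is positive recurrent.
   Context: $\mathbb N=\{0,1,2,\dots\}$. Fix an integer $N\ge 2$ and a constant $B>0$. There are $N$ queues indexed by $1,\dots,N$, equally spaced on a discrete torus; $d(i,j)=\min(|i-j|,N-|i-j|)$ is the circular distance between queues $i$ and $j$. The path-loss function $l$ is one of $\ell_1(r)=(A\max(r,r_0))^{-C}$, $\ell_2(r)=(1+Ar)^{-C}$, $\ell_3(r)=Ae^{-Cr}$, with $A,C,r_0>0$. Put $\xi_N=\sum_{j\ne i} l(d(i,j))$, which does not depend on $i$ by symmetry. For $q\in\mathbb N^N$ the service rate of queue $i$ is $\mu_i(q)=B\log_2\Bigl(1+\frac{1}{1+\sum_{j\neq i}\mathbf 1_{\{q_j>0\}}\,l(d(i,j))}\Bigr)$. $Q(t)=(q_1(t),\dots,q_N(t))$ is the (non-explosive) continuous-time Markov chain on $\mathbb N^N$ with generator, for bounded $f$, $$\mathcal L f(q)=\lambda\sum_{i=1}^N\bigl(f(q+e_i)-f(q)\bigr)-\sum_{i=1}^N\mu_i(q)\bigl(f(q)-f(q-e_i)\bigr)\mathbf 1_{\{q_i>0\}},$$ where $e_i$ is the $i$-th unit vector. *)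

theory Defs
  imports "HOL-Probability.Probability"
begin

section \<open>Continuous-time Markov chains with a given generator\<close>

text \<open>
  A chain on the countable discrete state space \<open>S\<close> is given by a family of probability
  measures \<open>P x\<close> (the law when started in \<open>x\<close>) and a right-continuous process
  \<open>(Q t)\<close>, \<open>t \<ge> 0\<close>, that takes its values in \<open>S\<close> at all times (no cemetery state).
  Its transition probabilities are \<open>p\<^sub>t(x,y) = P x (Q t = y)\<close>; the Markov property is stated
  through the finite-dimensional distributions, and \<open>L\<close> is the derivative at \<open>0\<close> of the
  transition semigroup on all bounded functions.
\<close>

locale ctmc =
  fixes S :: "'s set"
    and L :: "('s \<Rightarrow> real) \<Rightarrow> 's \<Rightarrow> real"
    and P :: "'s \<Rightarrow> 'w measure"
    and Q :: "real \<Rightarrow> 'w \<Rightarrow> 's"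
  assumes countable_states: "countable S"
    and prob_space: "x \<in> S \<Longrightarrow> prob_space (P x)"
    and same_events: "x \<in> S \<Longrightarrow> y \<in> S \<Longrightarrow> sets (P x) = sets (P y)"
    and measurable: "x \<in> S \<Longrightarrow> 0 \<le> t \<Longrightarrow> Q t \<in> measurable (P x) (count_space S)"
    and start: "x \<in> S \<Longrightarrow> AE w in P x. Q 0 w = x"
    and right_continuous: "x \<in> S \<Longrightarrow> w \<in> space (P x) \<Longrightarrow> 0 \<le> t \<Longrightarrow>
          \<forall>\<^sub>F u in at_right t. Q u w = Q t w"
    and markov: "x \<in> S \<Longrightarrow> 0 \<le> s 0 \<Longrightarrow> mono_on {..n} (s :: nat \<Rightarrow> real) \<Longrightarrow> (\<And>k. k \<le> n \<Longrightarrow> z k \<in> S) \<Longrightarrow>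
          0 \<le> h \<Longrightarrow> y \<in> S \<Longrightarrow>
          \<P>(w in P x. (\<forall>k\<le>n. Q (s k) w = z k) \<and> Q (s n + h) w = y)
            = \<P>(w in P x. \<forall>k\<le>n. Q (s k) w = z k) * \<P>(w in P (z n). Q h w = y)"
    and generator: "x \<in> S \<Longrightarrow> bounded (f ` S) \<Longrightarrow>
          ((\<lambda>h. ((\<integral>w. f (Q h w) \<partial>P x) - f x) / h) \<longlongrightarrow> L f x) (at_right 0)"

definition transient_state :: "('s \<Rightarrow> 'w measure) \<Rightarrow> (real \<Rightarrow> 'w \<Rightarrow> 's) \<Rightarrow> 's \<Rightarrow> bool" where
  "transient_state P Q x \<longleftrightarrow> (AE w in P x. bounded {t. 0 \<le> t \<and> Q t w = x})"

definition recurrent_state :: "('s \<Rightarrow> 'w measure) \<Rightarrow> (real \<Rightarrow> 'w \<Rightarrow> 's) \<Rightarrow> 's \<Rightarrow> bool" where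
  "recurrent_state P Q x \<longleftrightarrow> (AE w in P x. \<not> bounded {t. 0 \<le> t \<and> Q t w = x})"

definition first_jump_time :: "(real \<Rightarrow> 'w \<Rightarrow> 's) \<Rightarrow> 'w \<Rightarrow> ennreal" where
  "first_jump_time Q w = (INF t\<in>{t. 0 \<le> t \<and> Q t w \<noteq> Q 0 w}. ennreal t)"

definition return_time :: "(real \<Rightarrow> 'w \<Rightarrow> 's) \<Rightarrow> 's \<Rightarrow> 'w \<Rightarrow> ennreal" where
  "return_time Q x w = (INF t\<in>{t. 0 \<le> t \<and> first_jump_time Q w \<le> ennreal t \<and> Q t w = x}. ennreal t)"

text \<open>
  Infima of empty sets are \<open>\<infinity>\<close>.  In particular an absorbing state has infinite return time, so
  the following notion is meant for chains without absorbing states.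
\<close>

definition positive_recurrent_state :: "('s \<Rightarrow> 'w measure) \<Rightarrow> (real \<Rightarrow> 'w \<Rightarrow> 's) \<Rightarrow> 's \<Rightarrow> bool" where
  "positive_recurrent_state P Q x \<longleftrightarrow>
     recurrent_state P Q x \<and> (\<integral>\<^sup>+w. return_time Q x w \<partial>P x) < \<infinity>"

definition transient_chain :: "'s set \<Rightarrow> ('s \<Rightarrow> 'w measure) \<Rightarrow> (real \<Rightarrow> 'w \<Rightarrow> 's) \<Rightarrow> bool" where
  "transient_chain S P Q \<longleftrightarrow> (\<forall>x\<in>S. transient_state P Q x)"

definition positive_recurrent_chain :: "'s set \<Rightarrow> ('s \<Rightarrow> 'w measure) \<Rightarrow> (real \<Rightarrow> 'w \<Rightarrow> 's) \<Rightarrow> bool" where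
  "positive_recurrent_chain S P Q \<longleftrightarrow> (\<forall>x\<in>S. positive_recurrent_state P Q x)"


section \<open>Interference-coupled queues on the discrete torus\<close>

definition torus_dist :: "nat \<Rightarrow> nat \<Rightarrow> nat \<Rightarrow> real" where
  "torus_dist N i j = min \<bar>real i - real j\<bar> (real N - \<bar>real i - real j\<bar>)"

definition ell1 :: "real \<Rightarrow> real \<Rightarrow> real \<Rightarrow> real \<Rightarrow> real" where
  "ell1 A C r0 r = (A * max r r0) powr (- C)"

definition ell2 :: "real \<Rightarrow> real \<Rightarrow> real \<Rightarrow> real" where
  "ell2 A C r = (1 + A * r) powr (- C)"

definition ell3 :: "real \<Rightarrow> real \<Rightarrow> real \<Rightarrow> real" where
  "ell3 A C r = A * exp (- C * r)"

definition path_loss :: "(real \<Rightarrow> real) \<Rightarrow> bool" where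
  "path_loss l \<longleftrightarrow> (\<exists>A>0. \<exists>C>0. \<exists>r0>0. l = ell1 A C r0 \<or> l = ell2 A C \<or> l = ell3 A C)"

text \<open>The sum is taken at queue \<open>1\<close>; by \<open>xi_eq\<close> below every other queue gives the same value.\<close>

definition xi :: "nat \<Rightarrow> (real \<Rightarrow> real) \<Rightarrow> real" where
  "xi N l = (\<Sum>j\<in>{1..N} - {1}. l (torus_dist N 1 j))"

definition mu_star :: "nat \<Rightarrow> real \<Rightarrow> (real \<Rightarrow> real) \<Rightarrow> real" where
  "mu_star N B l = B * log 2 (1 + 1 / (1 + xi N l))"

definition states :: "nat \<Rightarrow> (nat \<Rightarrow> nat) set" where
  "states N = {1..N} \<rightarrow>\<^sub>E (UNIV :: nat set)"

definition service_rate :: "nat \<Rightarrow> real \<Rightarrow> (real \<Rightarrow> real) \<Rightarrow> (nat \<Rightarrow> nat) \<Rightarrow> nat \<Rightarrow> real" where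
  "service_rate N B l q i =
     B * log 2 (1 + 1 / (1 + (\<Sum>j\<in>{1..N} - {i}. of_bool (q j > 0) * l (torus_dist N i j))))"

definition queue_generator ::
  "nat \<Rightarrow> real \<Rightarrow> (real \<Rightarrow> real) \<Rightarrow> real \<Rightarrow> ((nat \<Rightarrow> nat) \<Rightarrow> real) \<Rightarrow> (nat \<Rightarrow> nat) \<Rightarrow> real" where
  "queue_generator N B l lam f q =
     lam * (\<Sum>i\<in>{1..N}. (f (q(i := q i + 1)) - f q))
     - (\<Sum>i\<in>{1..N}. service_rate N B l q i * (f q - f (q(i := q i - 1))) * of_bool (q i > 0))"

lemma xi_eq:
  assumes "i \<in> {1..N}"
  shows "(\<Sum>j\<in>{1..N} - {i}. l (torus_dist N i j)) = xi N l"
proof -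
  have rotate: "(\<Sum>j\<in>{1..N} - {i}. l (torus_dist N i j))
      = (\<Sum>k\<in>{1..<N}. l (min (real k) (real N - real k)))" if i: "i \<in> {1..N}" for i
    by (rule sum.reindex_bij_witness[where
          i = "\<lambda>k. if i + k \<le> N then i + k else i + k - N" and
          j = "\<lambda>j. if i < j then j - i else j + N - i"])
       (use i in \<open>auto simp: torus_dist_def of_nat_diff min.commute intro!: arg_cong[where f = l]\<close>)
  show ?thesis
    unfolding xi_def using rotate[OF assms] rotate[of 1] assms by auto
qed

end

theory Submission
  imports Defs
begin

text \<open>
  All rates are bounded by a common constant \<open>\<Lambda>\<close>, so everything can be read off from the chain
  observed at integer times, together with one observation: a state occupied at some time is occupied
  a time \<open>t\<close> later with probability at least \<open>exp (- \<Lambda> t)\<close>.  No stopping times in continuous time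
  occur.  Write \<open>p\<^sub>t(x,y)\<close> for the transition probabilities.

  Transience for \<open>\<lambda> > \<mu>\<^sup>*\<close>: choose \<open>\<theta> < 1\<close> with \<open>\<mu>\<^sup>* < \<lambda> \<theta>\<close>.  While all queues are busy, each of them is
  served at rate exactly \<open>\<mu>\<^sup>*\<close>, and \<open>f q = (\<Sum>i. \<theta> ^ q i)\<close> has negative drift.  As soon as one queue is
  empty, \<open>f \<ge> 1\<close>.  Hence the truncation \<open>min f 1\<close> is bounded and superharmonic on the whole state
  space, and strictly so at states with large queues (\<open>generator_geometric_neg\<close>,
  \<open>generator_min_le\<close>).  Its expectation along the chain decreases by at least a fixed amount for every visit
  to such a state \<open>z\<close> at an integer time, so \<open>\<Sum>k. p\<^sub>k(x,z)\<close> converges.  As \<open>z\<close> can be reached from \<open>x\<close>,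
  \<open>\<Sum>k. p\<^sub>k(x,x)\<close> converges too, and Borel--Cantelli leaves only finitely many unit time intervals
  with a visit to \<open>x\<close> (\<open>transience_criterion\<close>).

  Positive recurrence for \<open>\<lambda> < \<mu>\<^sup>*\<close>: a busy queue is always served at rate at least \<open>\<mu>\<^sup>*\<close>, because
  idle neighbours only reduce interference.  So \<open>energy q = (\<Sum>i. (q i)\<^sup>2)\<close> has drift at most \<open>-1\<close>
  outside a finite set \<open>F\<close> (\<open>generator_energy_le\<close>).  Fix \<open>z \<noteq> x\<close> and let \<open>T\<close> be the first time that
  the integer skeleton steps from \<open>z\<close> to \<open>x\<close>; such a step certifies a jump followed by a return, so
  \<open>T\<close> dominates the return time.  From \<open>F\<close> the step is made soon with probability bounded below,
  so the expected number of visits to \<open>F\<close> before \<open>T\<close> is finite; each unit of time outside \<open>F\<close>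
  costs one unit of energy, so \<open>T\<close> itself has finite mean (\<open>summable_avoid\<close>).  The same count, started
  at an arbitrary time \<open>m\<close>, shows that \<open>x\<close> is visited again and again.

  The generator is given on bounded functions only.  Unbounded test functions are therefore
  truncated; truncation from above preserves upper bounds on the drift because the minimum with a
  constant is concave, and the truncation level is removed at the very end.
\<close>

section \<open>Random variables with countable range\<close>

text \<open>
  The measures of the chain live on an unspecified space of paths.  Passing to the law as a
  probability mass function turns all identities below into computations with discrete measures,
  where every function is measurable.
\<close>

definition law_pmf :: "'w measure \<Rightarrow> ('w \<Rightarrow> 'a) \<Rightarrow> 'a pmf" where
  "law_pmf M X = Abs_pmf (distr M (count_space UNIV) X)"

locale countable_rv = prob_space M for M :: "'w measure" +
  fixes X :: "'w \<Rightarrow> 'a" and A :: "'a set"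
  assumes countable_range: "countable A"
    and in_range: "w \<in> space M \<Longrightarrow> X w \<in> A"
    and point_measurable: "a \<in> A \<Longrightarrow> {w \<in> space M. X w = a} \<in> sets M"
begin

lemma measurable_rv: "X \<in> measurable M (count_space UNIV)"
proof -
  have "X \<in> measurable M (count_space A)"
    using in_range point_measurable countable_range
    by (subst measurable_count_space_eq_countable)
       (auto simp: vimage_def Int_def conj_commute)
  then show ?thesis
    using measurable_compose[of X M "count_space A" "\<lambda>x. x" "count_space UNIV"] by simp
qed

lemma measure_law: "measure_pmf (law_pmf M X) = distr M (count_space UNIV) X"
proof -
  interpret D: prob_space "distr M (count_space UNIV) X"
    by (rule prob_space_distr[OF measurable_rv])
  have "AE x in distr M (count_space UNIV) X. x \<in> A"
    using in_range by (subst AE_distr_iff[OF measurable_rv]) auto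
  then have "AE x in distr M (count_space UNIV) X. measure (distr M (count_space UNIV) X) {x} \<noteq> 0"
    using countable_range by (subst D.AE_support_countable) auto
  then show ?thesis
    unfolding law_pmf_def using D.prob_space_axioms by (subst Abs_pmf_inverse) auto
qed

lemma prob_law: "measure_pmf.prob (law_pmf M X) B = measure M {w \<in> space M. X w \<in> B}"
  unfolding measure_law by (subst measure_distr[OF measurable_rv]) (auto simp: vimage_def Int_def conj_commute)

lemma pmf_law: "pmf (law_pmf M X) a = measure M {w \<in> space M. X w = a}"
  using prob_law[of "{a}"] by (simp add: pmf.rep_eq)

lemma expectation_law:
  "measure_pmf.expectation (law_pmf M X) f = (\<integral>w. f (X w) \<partial>M)" for f :: "'a \<Rightarrow> real"
  unfolding measure_law by (rule integral_distr[OF measurable_rv]) simp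

lemma sets_rv: "{w \<in> space M. X w \<in> B} \<in> sets M"
  using measurable_sets[OF measurable_rv, of B] by (simp add: vimage_def Int_def conj_commute)

lemma integrable_rv:
  fixes f :: "'a \<Rightarrow> real"
  assumes "\<And>a. \<bar>f a\<bar> \<le> c"
  shows "integrable M (\<lambda>w. f (X w))"
  by (rule integrable_const_bound[where B = c])
     (use assms measurable_compose[OF measurable_rv, of f borel] in auto)

lemma set_law: "set_pmf (law_pmf M X) \<subseteq> A"
proof
  fix a assume "a \<in> set_pmf (law_pmf M X)"
  then have "measure M {w \<in> space M. X w = a} \<noteq> 0" by (simp add: set_pmf_iff pmf_law)
  then have "{w \<in> space M. X w = a} \<noteq> {}" by (metis measure_empty)
  then show "a \<in> A" using in_range by auto
qed

end

lemma integrable_pmf_bounded: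
  fixes f :: "'a \<Rightarrow> real"
  assumes "\<And>x. x \<in> set_pmf p \<Longrightarrow> \<bar>f x\<bar> \<le> c"
  shows "integrable (measure_pmf p) f"
  by (rule measure_pmf.integrable_const_bound[where B = c]) (use assms in \<open>auto simp: AE_measure_pmf_iff\<close>)

lemma expectation_pmf_mono:
  fixes f g :: "'a \<Rightarrow> real"
  assumes "\<And>x. x \<in> set_pmf p \<Longrightarrow> \<bar>f x\<bar> \<le> c" "\<And>x. x \<in> set_pmf p \<Longrightarrow> \<bar>g x\<bar> \<le> d"
    and "\<And>x. x \<in> set_pmf p \<Longrightarrow> f x \<le> g x"
  shows "measure_pmf.expectation p f \<le> measure_pmf.expectation p g"
  by (rule integral_mono_AE[OF integrable_pmf_bounded[OF assms(1)] integrable_pmf_bounded[OF assms(2)]])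
     (use assms(3) in \<open>auto simp: AE_measure_pmf_iff\<close>)

lemma abs_expectation_pmf_le:
  fixes f :: "'a \<Rightarrow> real"
  assumes "\<And>x. x \<in> set_pmf p \<Longrightarrow> \<bar>f x\<bar> \<le> c"
  shows "\<bar>measure_pmf.expectation p f\<bar> \<le> c"
proof -
  have "\<bar>measure_pmf.expectation p f\<bar> \<le> measure_pmf.expectation p (\<lambda>x. \<bar>f x\<bar>)"
    by (rule integral_abs_bound)
  also have "\<dots> \<le> measure_pmf.expectation p (\<lambda>_. c)"
    by (rule expectation_pmf_mono[where c = c and d = "\<bar>c\<bar>"]) (use assms in auto)
  finally show ?thesis by simp
qed

lemma expectation_pmf_nonpos:
  fixes f :: "'a \<Rightarrow> real"
  assumes "\<And>x. x \<in> set_pmf p \<Longrightarrow> f x \<le> 0"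
  shows "measure_pmf.expectation p f \<le> 0"
  using integral_nonneg_AE[of "\<lambda>x. - f x" "measure_pmf p"] assms by (auto simp: AE_measure_pmf_iff)

lemma expectation_bind_pmf:
  fixes f :: "'b \<Rightarrow> real"
  assumes "\<And>x. \<bar>f x\<bar> \<le> c"
  shows "measure_pmf.expectation (bind_pmf p k) f
       = measure_pmf.expectation p (\<lambda>x. measure_pmf.expectation (k x) f)"
  unfolding measure_pmf_bind
proof (rule integral_bind[where K = "count_space UNIV" and B = c and B' = 1])
qed (use assms measurable_measure_pmf[of k] in \<open>auto simp: measure_pmf.finite_measure measure_pmf.emeasure_space_1\<close>)

section \<open>Transition kernels and the Markov property\<close>

context ctmc
begin

definition kernel :: "real \<Rightarrow> 's \<Rightarrow> 's pmf" where
  "kernel t x = law_pmf (P x) (Q t)"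

lemma state_rv: "x \<in> S \<Longrightarrow> 0 \<le> t \<Longrightarrow> countable_rv (P x) (Q t) S"
  using prob_space[of x] measurable[of x t] countable_states
  by (auto simp: countable_rv_def countable_rv_axioms_def measurable_count_space_eq_countable
      vimage_def Int_def conj_commute)

lemma Q_in_S: "x \<in> S \<Longrightarrow> 0 \<le> t \<Longrightarrow> w \<in> space (P x) \<Longrightarrow> Q t w \<in> S"
  using countable_rv.in_range[OF state_rv] .

lemma sets_Q: "x \<in> S \<Longrightarrow> 0 \<le> t \<Longrightarrow> {w \<in> space (P x). Q t w \<in> A} \<in> sets (P x)"
  using measurable_sets[OF countable_rv.measurable_rv[OF state_rv], of x t A]
  by (simp add: vimage_def Int_def conj_commute)

text \<open>
  The history at finitely many times, as a single variable.  Restricting to \<open>{..n}\<close> makes it range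
  over a countable set, so that its law is again discrete.
\<close>

definition past :: "(nat \<Rightarrow> real) \<Rightarrow> nat \<Rightarrow> 'w \<Rightarrow> nat \<Rightarrow> 's" where
  "past s n w = restrict (\<lambda>k. Q (s k) w) {..n}"

lemma past_apply [simp]: "k \<le> n \<Longrightarrow> past s n w k = Q (s k) w"
  by (simp add: past_def)

lemma past_eq_iff:
  assumes "z \<in> extensional {..n}"
  shows "past s n w = z \<longleftrightarrow> (\<forall>k\<le>n. Q (s k) w = z k)"
proof -
  have "past s n w = z \<longleftrightarrow> (\<forall>k\<in>{..n}. past s n w k = z k)"
    using extensionalityI[of "past s n w" "{..n}" z] assms by (auto simp: past_def)
  then show ?thesis by (auto simp: past_def)
qed

lemma past_rv:
  assumes x: "x \<in> S" and s: "\<And>k. k \<le> n \<Longrightarrow> 0 \<le> s k"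
  shows "countable_rv (P x) (past s n) ({..n} \<rightarrow>\<^sub>E S)"
proof (intro countable_rv.intro countable_rv_axioms.intro prob_space x)
  show "countable ({..n} \<rightarrow>\<^sub>E S)" by (rule countable_PiE) (auto intro: countable_states)
  show "past s n w \<in> {..n} \<rightarrow>\<^sub>E S" if "w \<in> space (P x)" for w
    unfolding past_def using that x s Q_in_S by auto
  fix z assume z: "z \<in> {..n} \<rightarrow>\<^sub>E S"
  have "{w \<in> space (P x). past s n w = z} = {w \<in> space (P x). \<forall>k\<in>{..n}. Q (s k) w \<in> {z k}}"
    using z by (auto simp: past_eq_iff PiE_def)
  also have "\<dots> \<in> sets (P x)"
    by (rule sets.sets_Collect_finite_All) (assumption | rule finite_atMost sets_Q x s | simp only: atMost_iff)+
  finally show "{w \<in> space (P x). past s n w = z} \<in> sets (P x)" .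
qed

lemma past_next_rv:
  assumes x: "x \<in> S" and s: "\<And>k. k \<le> n \<Longrightarrow> 0 \<le> s k" and h: "0 \<le> h"
  shows "countable_rv (P x) (\<lambda>w. (past s n w, Q (s n + h) w)) (({..n} \<rightarrow>\<^sub>E S) \<times> S)"
proof -
  interpret A: countable_rv "P x" "past s n" "{..n} \<rightarrow>\<^sub>E S" by (rule past_rv[OF x s])
  interpret B: countable_rv "P x" "Q (s n + h)" S by (rule state_rv) (use x h s[of n] in auto)
  show ?thesis
  proof unfold_locales
    show "countable (({..n} \<rightarrow>\<^sub>E S) \<times> S)" using A.countable_range B.countable_range by auto
    show "(past s n w, Q (s n + h) w) \<in> ({..n} \<rightarrow>\<^sub>E S) \<times> S" if "w \<in> space (P x)" for w
      using A.in_range[OF that] B.in_range[OF that] by auto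
    fix a assume a: "a \<in> ({..n} \<rightarrow>\<^sub>E S) \<times> S"
    have "{w \<in> space (P x). (past s n w, Q (s n + h) w) = a}
        = {w \<in> space (P x). past s n w = fst a} \<inter> {w \<in> space (P x). Q (s n + h) w = snd a}" by auto
    also have "\<dots> \<in> sets (P x)"
      using a by (intro sets.Int A.point_measurable B.point_measurable) auto
    finally show "{w \<in> space (P x). (past s n w, Q (s n + h) w) = a} \<in> sets (P x)" .
  qed
qed

text \<open>
  Both sides are discrete, so they agree as soon as their point masses do, and equality of the point
  masses is the Markov property.
\<close>

lemma law_past_next:
  assumes x: "x \<in> S" and s0: "0 \<le> s 0" and mono: "mono_on {..n} s" and h: "0 \<le> h"
  shows "law_pmf (P x) (\<lambda>w. (past s n w, Q (s n + h) w))
       = bind_pmf (law_pmf (P x) (past s n)) (\<lambda>z. map_pmf (Pair z) (kernel h (z n)))"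
    (is "?l = ?r")
proof (rule pmf_eqI)
  fix a :: "(nat \<Rightarrow> 's) \<times> 's"
  obtain z y where a: "a = (z, y)" by (cases a)
  have s: "0 \<le> s k" if "k \<le> n" for k
    using mono_onD[OF mono, of 0 k] that s0 by simp
  interpret A: countable_rv "P x" "past s n" "{..n} \<rightarrow>\<^sub>E S" by (rule past_rv[OF x s])
  interpret C: countable_rv "P x" "\<lambda>w. (past s n w, Q (s n + h) w)" "({..n} \<rightarrow>\<^sub>E S) \<times> S"
    by (rule past_next_rv[OF x s h])
  have pt: "pmf (map_pmf (Pair z') (kernel h (z' n))) a = indicator {z} z' * pmf (kernel h (z n)) y" for z'
  proof (cases "z' = z")
    case True
    then show ?thesis by (simp add: a pmf_map_inj' inj_on_def)
  next
    case False
    then have "a \<notin> set_pmf (map_pmf (Pair z') (kernel h (z' n)))" by (auto simp: a)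
    then show ?thesis using False unfolding pmf_eq_0_set_pmf[symmetric] by simp
  qed
  have r: "pmf ?r a = pmf (law_pmf (P x) (past s n)) z * pmf (kernel h (z n)) y"
    unfolding pmf_bind pt by (simp add: pmf.rep_eq)
  show "pmf ?l a = pmf ?r a"
  proof (cases "z \<in> {..n} \<rightarrow>\<^sub>E S \<and> y \<in> S")
    case True
    then have z: "z \<in> {..n} \<rightarrow>\<^sub>E S" and y: "y \<in> S" by auto
    then have zS: "\<And>k. k \<le> n \<Longrightarrow> z k \<in> S" and ze: "z \<in> extensional {..n}" by (auto simp: PiE_def)
    interpret D: countable_rv "P (z n)" "Q h" S by (rule state_rv) (use zS h in auto)
    have "pmf ?l a = \<P>(w in P x. (\<forall>k\<le>n. Q (s k) w = z k) \<and> Q (s n + h) w = y)"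
      unfolding C.pmf_law using past_eq_iff[OF ze, of s] by (simp add: a)
    also have "\<dots> = \<P>(w in P x. \<forall>k\<le>n. Q (s k) w = z k) * \<P>(w in P (z n). Q h w = y)"
      by (rule markov[OF x s0 mono zS h y])
    also have "\<dots> = pmf ?r a"
      unfolding r A.pmf_law by (simp add: past_eq_iff[OF ze] D.pmf_law[folded kernel_def])
    finally show ?thesis .
  next
    case False
    have "pmf ?l a = 0"
      using False C.set_law by (auto simp: a set_pmf_iff[symmetric] pmf_eq_0_set_pmf)
    moreover have "pmf ?r a = 0"
    proof (cases "z \<in> {..n} \<rightarrow>\<^sub>E S")
      case True
      then have "y \<notin> S" and zn: "z n \<in> S" using False by (auto simp: PiE_def)
      then have "y \<notin> set_pmf (kernel h (z n))"
        using countable_rv.set_law[OF state_rv[OF zn h]] by (auto simp: kernel_def)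
      then show ?thesis by (simp add: r pmf_eq_0_set_pmf)
    next
      case False
      then have "pmf (law_pmf (P x) (past s n)) z = 0"
        using A.set_law by (auto simp: pmf_eq_0_set_pmf)
      then show ?thesis by (simp add: r)
    qed
    ultimately show ?thesis by simp
  qed
qed

lemma markov_expectation:
  fixes \<phi> :: "(nat \<Rightarrow> 's) \<Rightarrow> real" and f :: "'s \<Rightarrow> real"
  assumes x: "x \<in> S" and s0: "0 \<le> s 0" and mono: "mono_on {..n} s" and h: "0 \<le> h"
    and \<phi>: "\<And>z. \<bar>\<phi> z\<bar> \<le> c" and f: "\<And>y. \<bar>f y\<bar> \<le> d"
  shows "(\<integral>w. \<phi> (past s n w) * f (Q (s n + h) w) \<partial>P x)
       = (\<integral>w. \<phi> (past s n w) * measure_pmf.expectation (kernel h (Q (s n) w)) f \<partial>P x)"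
proof -
  have s: "0 \<le> s k" if "k \<le> n" for k
    using mono_onD[OF mono, of 0 k] that s0 by simp
  interpret A: countable_rv "P x" "past s n" "{..n} \<rightarrow>\<^sub>E S" by (rule past_rv[OF x s])
  interpret C: countable_rv "P x" "\<lambda>w. (past s n w, Q (s n + h) w)" "({..n} \<rightarrow>\<^sub>E S) \<times> S"
    by (rule past_next_rv[OF x s h])
  have bd: "\<bar>case a of (z, y) \<Rightarrow> \<phi> z * f y\<bar> \<le> c * d" for a
    using \<phi> f by (auto simp: abs_mult split: prod.split intro!: mult_mono order_trans[OF abs_ge_zero \<phi>])
  have "(\<integral>w. \<phi> (past s n w) * f (Q (s n + h) w) \<partial>P x)
      = measure_pmf.expectation (law_pmf (P x) (\<lambda>w. (past s n w, Q (s n + h) w))) (\<lambda>(z, y). \<phi> z * f y)"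
    by (simp add: C.expectation_law)
  also have "\<dots> = measure_pmf.expectation (law_pmf (P x) (past s n))
      (\<lambda>z. measure_pmf.expectation (map_pmf (Pair z) (kernel h (z n))) (\<lambda>(z, y). \<phi> z * f y))"
    unfolding law_past_next[OF x s0 mono h] by (rule expectation_bind_pmf[OF bd])
  also have "\<dots> = measure_pmf.expectation (law_pmf (P x) (past s n))
      (\<lambda>z. \<phi> z * measure_pmf.expectation (kernel h (z n)) f)"
    by simp
  also have "\<dots> = (\<integral>w. \<phi> (past s n w) * measure_pmf.expectation (kernel h (past s n w n)) f \<partial>P x)"
    by (simp add: A.expectation_law)
  finally show ?thesis by (simp add: past_def)
qed

lemma pmf_kernel:
  assumes "x \<in> S" "0 \<le> t"
  shows "pmf (kernel t x) y = \<P>(w in P x. Q t w = y)"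
  unfolding kernel_def by (rule countable_rv.pmf_law[OF state_rv[OF assms]])

lemma expectation_kernel:
  fixes f :: "'s \<Rightarrow> real"
  assumes "x \<in> S" "0 \<le> t"
  shows "measure_pmf.expectation (kernel t x) f = (\<integral>w. f (Q t w) \<partial>P x)"
  unfolding kernel_def by (rule countable_rv.expectation_law[OF state_rv[OF assms]])

lemma set_kernel: "x \<in> S \<Longrightarrow> 0 \<le> t \<Longrightarrow> set_pmf (kernel t x) \<subseteq> S"
  unfolding kernel_def by (rule countable_rv.set_law[OF state_rv])

lemma kernel_0: "x \<in> S \<Longrightarrow> kernel 0 x = return_pmf x"
proof -
  assume x: "x \<in> S"
  interpret prob_space "P x" by (rule prob_space[OF x])
  have one: "pmf (kernel 0 x) x = 1"
    unfolding pmf_kernel[OF x order_refl] using start[OF x] sets_Q[OF x order_refl, of "{x}"]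
    by (subst prob_Collect_eq_1) auto
  have "pmf (kernel 0 x) y = 0" if "y \<noteq> x" for y
  proof -
    have "pmf (kernel 0 x) x + pmf (kernel 0 x) y = measure_pmf.prob (kernel 0 x) {x, y}"
      using that by (simp add: measure_measure_pmf_finite)
    also have "\<dots> \<le> 1" by simp
    finally show ?thesis using one by (simp add: order_antisym)
  qed
  with one show ?thesis by (intro pmf_eqI) (auto simp: pmf_return indicator_def)
qed

lemma chapman_kolmogorov:
  fixes f :: "'s \<Rightarrow> real"
  assumes x: "x \<in> S" and "0 \<le> t" "0 \<le> h" and f: "\<And>y. \<bar>f y\<bar> \<le> d"
  shows "measure_pmf.expectation (kernel (t + h) x) f
       = measure_pmf.expectation (kernel t x) (\<lambda>y. measure_pmf.expectation (kernel h y) f)"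
  using markov_expectation[where n = 0 and s = "\<lambda>_. t" and \<phi> = "\<lambda>_. 1" and c = 1, OF x _ _ \<open>0 \<le> h\<close> _ f]
  by (simp add: assms expectation_kernel mono_on_def)

text \<open>
  One way to be in \<open>z\<close> at time \<open>t + h\<close> is to be in \<open>y\<close> at time \<open>t\<close>.
\<close>

lemma kernel_add_ge:
  assumes x: "x \<in> S" and t: "0 \<le> t" "0 \<le> h"
  shows "pmf (kernel t x) y * pmf (kernel h y) z \<le> pmf (kernel (t + h) x) z"
proof -
  have ind: "measure_pmf.expectation p (indicat_real {z}) = pmf p z" for p z
    by (simp add: pmf.rep_eq)
  have "pmf (kernel (t + h) x) z = measure_pmf.expectation (kernel t x) (\<lambda>y. pmf (kernel h y) z)"
    using chapman_kolmogorov[OF x t, of "indicat_real {z}" 1] unfolding ind by (auto simp: indicator_def)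
  moreover have "measure_pmf.expectation (kernel t x) (\<lambda>u. indicator {y} u * pmf (kernel h y) z)
      \<le> measure_pmf.expectation (kernel t x) (\<lambda>y. pmf (kernel h y) z)"
    by (rule expectation_pmf_mono[where c = 1 and d = 1]) (auto simp: indicator_def pmf_le_1)
  ultimately show ?thesis by (simp add: pmf.rep_eq)
qed

end

section \<open>Chains with bounded rates: the forward equation\<close>

text \<open>
  The semigroup comes with right derivatives only, so the mean value theorem does not apply directly.
  With slack \<open>\<epsilon>\<close> in the slope, a last time at which the bound holds cannot lie before \<open>T\<close>, since the
  right derivative carries the bound a little further.
\<close>

lemma right_derivative_upper_bound:
  fixes \<phi> D :: "real \<Rightarrow> real"
  assumes T: "0 \<le> T" and cont: "continuous_on {0..T} \<phi>"
    and der: "\<And>t. 0 \<le> t \<Longrightarrow> t < T \<Longrightarrow> ((\<lambda>h. (\<phi> (t + h) - \<phi> t) / h) \<longlongrightarrow> D t) (at_right 0)"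
    and D: "\<And>t. 0 \<le> t \<Longrightarrow> t < T \<Longrightarrow> D t \<le> k"
  shows "\<phi> T \<le> \<phi> 0 + k * T"
proof -
  have approx: "\<phi> T \<le> \<phi> 0 + (k + \<epsilon>) * T" if \<epsilon>: "\<epsilon> > 0" for \<epsilon>
  proof (rule ccontr)
    \<comment> \<open>the violation of the bound; \<open>t\<close> below is the last time without violation\<close>
    define \<psi> where "\<psi> t = \<phi> t - \<phi> 0 - (k + \<epsilon>) * t" for t
    assume "\<not> ?thesis"
    then have pos: "\<psi> T > 0" by (simp add: \<psi>_def)
    let ?A = "{t \<in> {0..T}. \<psi> t \<le> 0}"
    have "continuous_on {0..T} \<psi>" unfolding \<psi>_def by (intro continuous_intros cont)
    then have "closed ?A"
      using continuous_closed_preimage[of "{0..T}" \<psi> "{..0}"] by (auto simp: vimage_def Int_def)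
    then have "compact ?A"
      by (auto simp: compact_eq_bounded_closed intro: bounded_subset[of "{0..T}"])
    moreover have "0 \<in> ?A" using T by (simp add: \<psi>_def)
    ultimately obtain t where t: "t \<in> ?A" and max: "\<And>u. u \<in> ?A \<Longrightarrow> u \<le> t"
      using compact_attains_sup[of ?A] by auto
    have "t < T" using t pos by (cases "t = T") auto
    then have "((\<lambda>h. (\<phi> (t + h) - \<phi> t) / h) \<longlongrightarrow> D t) (at_right 0)" and "D t < k + \<epsilon>"
      using der[of t] D[of t] t \<epsilon> by auto
    then have "\<forall>\<^sub>F h in at_right 0. (\<phi> (t + h) - \<phi> t) / h < k + \<epsilon>" by (rule order_tendstoD)
    moreover have "\<forall>\<^sub>F h in at_right 0. 0 < h \<and> h < T - t"
      using \<open>t < T\<close> by (auto simp: eventually_at_right_field intro!: exI[of _ "T - t"])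
    ultimately have "\<forall>\<^sub>F h in at_right 0. (\<phi> (t + h) - \<phi> t) / h < k + \<epsilon> \<and> 0 < h \<and> h < T - t"
      by eventually_elim auto
    then obtain h where h: "(\<phi> (t + h) - \<phi> t) / h < k + \<epsilon>" "0 < h" "h < T - t"
      using eventually_happens'[of "at_right (0::real)"] by auto
    then have "\<psi> (t + h) \<le> \<psi> t" by (simp add: \<psi>_def field_simps)
    then have "t + h \<in> ?A" using t h by auto
    from max[OF this] h show False by simp
  qed
  have "((\<lambda>\<epsilon>. \<phi> 0 + (k + \<epsilon>) * T) \<longlongrightarrow> \<phi> 0 + (k + 0) * T) (at_right 0)"
    by (intro tendsto_intros)
  then have "\<phi> T \<le> \<phi> 0 + (k + 0) * T"
    by (rule tendsto_lowerbound) (auto simp: eventually_at_right_field intro!: exI[of _ 1] approx)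
  then show ?thesis by simp
qed
text \<open>
  The total jump rate out of \<open>x\<close> is \<open>- L (indicator {x}) x\<close>.  A strict bound costs nothing and avoids
  an extra \<open>\<epsilon>\<close> when passing from the derivative at \<open>0\<close> to small times.
\<close>

locale bounded_rate_ctmc = ctmc S L P Q
  for S :: "'s set" and L and P :: "'s \<Rightarrow> 'w measure" and Q +
  fixes \<Lambda> :: real
  assumes exit_rate_less: "x \<in> S \<Longrightarrow> - L (indicat_real {x}) x < \<Lambda>"
begin

abbreviation semigroup :: "real \<Rightarrow> ('s \<Rightarrow> real) \<Rightarrow> 's \<Rightarrow> real" where
  "semigroup t f x \<equiv> measure_pmf.expectation (kernel t x) f"

lemma generator_semigroup:
  assumes x: "x \<in> S" and f: "\<And>y. \<bar>f y\<bar> \<le> c"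
  shows "((\<lambda>h. (semigroup h f x - f x) / h) \<longlongrightarrow> L f x) (at_right 0)"
proof -
  have "bounded (f ` S)" unfolding bounded_iff using f by auto
  from generator[OF x this]
  show ?thesis
    by (rule Lim_transform_eventually)
       (auto simp: eventually_at_right_field expectation_kernel x intro!: exI[of _ 1])
qed

lemma generator_pmf:
  assumes "x \<in> S"
  shows "((\<lambda>h. (pmf (kernel h x) y - indicator {y} x) / h) \<longlongrightarrow> L (indicat_real {y}) x) (at_right 0)"
  using generator_semigroup[OF assms, of "indicat_real {y}" 1]
  by (simp add: pmf.rep_eq indicator_def)

lemma stay_power:
  assumes "x \<in> S" "0 \<le> h"
  shows "pmf (kernel h x) x ^ n \<le> pmf (kernel (real n * h) x) x"
proof (induction n)
  case 0
  then show ?case using assms by (simp add: kernel_0)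
next
  case (Suc n)
  have "pmf (kernel h x) x ^ Suc n \<le> pmf (kernel h x) x * pmf (kernel (real n * h) x) x"
    using Suc by (simp add: mult_left_mono)
  also have "\<dots> \<le> pmf (kernel (h + real n * h) x) x"
    by (rule kernel_add_ge) (use assms in auto)
  finally show ?case by (simp add: algebra_simps)
qed

text \<open>
  By the derivative at \<open>0\<close>, \<open>p\<^sub>h(x,x) \<ge> 1 - \<Lambda> h\<close> for small \<open>h\<close>; being in \<open>x\<close> at all multiples of
  \<open>t / n\<close> up to \<open>t\<close> then has probability at least \<open>(1 - \<Lambda> t / n) ^ n\<close>,
  which tends to the exponential.  The threshold for \<open>h\<close> depends
  on \<open>x\<close>, but the resulting bound does not: this is where uniformity over states is gained.
\<close>

lemma stay_prob:
  assumes x: "x \<in> S" and t: "0 \<le> t"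
  shows "exp (- \<Lambda> * t) \<le> pmf (kernel t x) x"
proof (cases "t = 0")
  case True
  then show ?thesis using x by (simp add: kernel_0)
next
  case False
  then have t: "t > 0" using t by simp
  have "\<forall>\<^sub>F h in at_right 0. (pmf (kernel h x) x - 1) / h > - \<Lambda>"
    using order_tendstoD(1)[OF generator_pmf[OF x, of x]] exit_rate_less[OF x] by simp
  then obtain h0 where h0: "h0 > 0" "\<And>h. 0 < h \<Longrightarrow> h < h0 \<Longrightarrow> (pmf (kernel h x) x - 1) / h > - \<Lambda>"
    unfolding eventually_at_right_field by auto
  have small: "1 - \<Lambda> * h \<le> pmf (kernel h x) x" if "0 < h" "h < h0" for h
    using h0(2)[OF that] that by (simp add: field_simps)
  have tn: "(\<lambda>n. t / real n) \<longlonglongrightarrow> 0" by (rule lim_const_over_n)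
  then have "(\<lambda>n. 1 + (- \<Lambda>) * (t / real n)) \<longlonglongrightarrow> 1 + (- \<Lambda>) * 0" by (intro tendsto_intros)
  then have ev1: "\<forall>\<^sub>F n in sequentially. 1 + (- \<Lambda>) * (t / real n) > 0"
    by (rule order_tendstoD) simp
  have ev2: "\<forall>\<^sub>F n in sequentially. t / real n < h0"
    using order_tendstoD(2)[OF tn h0(1)] .
  have "\<forall>\<^sub>F n in sequentially. (1 + (- \<Lambda> * t) / real n) ^ n \<le> pmf (kernel t x) x"
    using ev1 ev2 eventually_gt_at_top[of 0]
  proof eventually_elim
    case (elim n)
    have "(1 + (- \<Lambda> * t) / real n) ^ n \<le> pmf (kernel (t / real n) x) x ^ n"
      using elim small[of "t / real n"] t by (intro power_mono) (auto simp: algebra_simps)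
    also have "\<dots> \<le> pmf (kernel t x) x"
      using stay_power[OF x, of "t / real n" n] elim t by simp
    finally show ?case .
  qed
  then show ?thesis
    using tendsto_exp_limit_sequentially[of "- \<Lambda> * t"] by (intro tendsto_upperbound) auto
qed

lemma rate_nonneg: "x \<in> S \<Longrightarrow> 0 \<le> \<Lambda>"
  using order_trans[OF stay_prob[of x 1] pmf_le_1] by simp

lemma kernel_pos_of_rate_pos:
  assumes x: "x \<in> S" and y: "y \<in> S" and "x \<noteq> y" and rate: "L (indicat_real {y}) x > 0" and t: "t > 0"
  shows "pmf (kernel t x) y > 0"
proof -
  have "\<forall>\<^sub>F h in at_right 0. (pmf (kernel h x) y - indicator {y} x) / h > 0"
    using order_tendstoD(1)[OF generator_pmf[OF x, of y] rate] .
  then obtain h0 where h0: "h0 > 0" "\<And>h. 0 < h \<Longrightarrow> h < h0 \<Longrightarrow> pmf (kernel h x) y / h > 0"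
    unfolding eventually_at_right_field using \<open>x \<noteq> y\<close> by auto
  define h where "h = min (h0 / 2) t"
  have h: "0 < h" "h < h0" "h \<le> t" using h0(1) t by (auto simp: h_def)
  have "0 < pmf (kernel h x) y" using h0(2)[OF h(1,2)] h(1) by (simp add: zero_less_divide_iff)
  moreover have "0 < pmf (kernel (t - h) y) y"
    using stay_prob[OF y, of "t - h"] h by (intro less_le_trans[OF exp_gt_zero]) auto
  ultimately have "0 < pmf (kernel h x) y * pmf (kernel (t - h) y) y" by simp
  also have "\<dots> \<le> pmf (kernel t x) y" using kernel_add_ge[OF x, of h "t - h" y y] h by simp
  finally show ?thesis .
qed

text \<open>
  Positivity is demanded at every positive time, so that the relation composes without tracking
  times and can be used directly at time \<open>1\<close>.
\<close>

definition reaches :: "'s \<Rightarrow> 's \<Rightarrow> bool" where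
  "reaches x y \<longleftrightarrow> (\<forall>t>0. 0 < pmf (kernel t x) y)"

lemma reaches_refl: "x \<in> S \<Longrightarrow> reaches x x"
  unfolding reaches_def using stay_prob by (meson exp_gt_zero less_imp_le less_le_trans)

lemma reaches_trans:
  assumes "x \<in> S" "reaches x y" "reaches y z"
  shows "reaches x z"
  unfolding reaches_def
proof (intro allI impI)
  fix t :: real assume "t > 0"
  then have "0 < pmf (kernel (t / 2) x) y * pmf (kernel (t / 2) y) z"
    using assms by (simp add: reaches_def)
  also have "\<dots> \<le> pmf (kernel t x) z"
    using kernel_add_ge[OF assms(1), of "t / 2" "t / 2" y z] \<open>t > 0\<close> by simp
  finally show "0 < pmf (kernel t x) z" .
qed

lemma reaches_of_rate_pos:
  "x \<in> S \<Longrightarrow> y \<in> S \<Longrightarrow> x \<noteq> y \<Longrightarrow> L (indicat_real {y}) x > 0 \<Longrightarrow> reaches x y"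
  unfolding reaches_def using kernel_pos_of_rate_pos by blast

lemma semigroup_increment_le:
  assumes x: "x \<in> S" and h: "0 \<le> h" and f: "\<And>y. \<bar>f y\<bar> \<le> c"
  shows "\<bar>semigroup h f x - f x\<bar> \<le> 2 * c * \<Lambda> * h"
proof -
  have c: "0 \<le> c" using f[of x] by linarith
  have int: "integrable (measure_pmf (kernel h x)) f" by (rule integrable_pmf_bounded) (rule f)
  have "semigroup h f x - f x = semigroup h (\<lambda>y. f y - f x) x"
    by (subst Bochner_Integration.integral_diff[OF int]) auto
  also have "\<bar>\<dots>\<bar> \<le> semigroup h (\<lambda>y. \<bar>f y - f x\<bar>) x" by (rule integral_abs_bound)
  also have "\<dots> \<le> semigroup h (\<lambda>y. 2 * c * (1 - indicator {x} y)) x"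
  proof (rule expectation_pmf_mono[where c = "2 * c" and d = "2 * c"])
    fix y
    show "\<bar>\<bar>f y - f x\<bar>\<bar> \<le> 2 * c" using f[of y] f[of x] by linarith
    show "\<bar>2 * c * (1 - indicator {x} y)\<bar> \<le> 2 * c" using c by (auto simp: indicator_def)
    show "\<bar>f y - f x\<bar> \<le> 2 * c * (1 - indicator {x} y)"
      using f[of y] f[of x] c by (auto simp: indicator_def)
  qed
  also have "\<dots> = 2 * c * (1 - pmf (kernel h x) x)"
    by (simp add: pmf.rep_eq integrable_pmf_bounded[where c = 1])
  also have "\<dots> \<le> 2 * c * (\<Lambda> * h)"
    using stay_prob[OF x h] exp_ge_add_one_self[of "- \<Lambda> * h"] c by (intro mult_left_mono) auto
  finally show ?thesis by (simp add: mult.assoc)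
qed

lemma semigroup_add_diff:
  assumes x: "x \<in> S" and t: "0 \<le> t" "0 \<le> h" and f: "\<And>y. \<bar>f y\<bar> \<le> c"
  shows "semigroup (t + h) f x - semigroup t f x = semigroup t (\<lambda>y. semigroup h f y - f y) x"
  unfolding chapman_kolmogorov[OF x t f]
  by (rule Bochner_Integration.integral_diff[symmetric]; rule integrable_pmf_bounded[where c = c])
     (auto intro!: f abs_expectation_pmf_le)

lemma continuous_on_semigroup:
  assumes x: "x \<in> S" and f: "\<And>y. \<bar>f y\<bar> \<le> c"
  shows "continuous_on {0..} (\<lambda>t. semigroup t f x)"
proof -
  have c: "0 \<le> c" using f[of x] by linarith
  have lip: "\<bar>semigroup (t + h) f x - semigroup t f x\<bar> \<le> 2 * c * \<Lambda> * h" if "0 \<le> t" "0 \<le> h" for t h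
    unfolding semigroup_add_diff[OF x that f]
  proof (rule abs_expectation_pmf_le)
    fix y assume "y \<in> set_pmf (kernel t x)"
    then have "y \<in> S" using set_kernel[OF x \<open>0 \<le> t\<close>] by blast
    from semigroup_increment_le[OF this \<open>0 \<le> h\<close> f]
    show "\<bar>semigroup h f y - f y\<bar> \<le> 2 * c * \<Lambda> * h" .
  qed
  have "(2 * c * \<Lambda>)-lipschitz_on {0..} (\<lambda>t. semigroup t f x)"
  proof (rule lipschitz_onI)
    show "0 \<le> 2 * c * \<Lambda>" using c rate_nonneg[OF x] by simp
    fix s t :: real assume st: "s \<in> {0..}" "t \<in> {0..}"
    show "dist (semigroup s f x) (semigroup t f x) \<le> 2 * c * \<Lambda> * dist s t"
    proof (cases "s \<le> t")
      case True
      then show ?thesis using lip[of s "t - s"] st by (simp add: dist_real_def abs_minus_commute)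
    next
      case False
      then show ?thesis using lip[of t "s - t"] st by (simp add: dist_real_def)
    qed
  qed
  then show ?thesis by (rule lipschitz_on_continuous_on)
qed

text \<open>
  The difference quotient at time \<open>t\<close> is the average over \<open>p\<^sub>t(x,\<cdot>)\<close> of the difference quotients at \<open>0\<close>.
  These converge pointwise, and \<open>stay_prob\<close> bounds them uniformly, so dominated convergence applies.
\<close>

lemma forward_equation:
  assumes x: "x \<in> S" and t: "0 \<le> t" and f: "\<And>y. \<bar>f y\<bar> \<le> c"
  shows "((\<lambda>h. (semigroup (t + h) f x - semigroup t f x) / h) \<longlongrightarrow> semigroup t (L f) x) (at_right 0)"
  unfolding tendsto_at_iff_sequentially
proof (intro allI impI)
  fix X :: "nat \<Rightarrow> real"
  assume X: "\<forall>i. X i \<in> {0<..} - {0}" "X \<longlonglongrightarrow> 0"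
  have Xpos: "0 < X i" for i using X(1) by auto
  have eq: "(semigroup (t + X i) f x - semigroup t f x) / X i
      = semigroup t (\<lambda>y. (semigroup (X i) f y - f y) / X i) x" for i
    using Xpos[of i] by (simp add: semigroup_add_diff[OF x t _ f])
  have "(\<lambda>i. semigroup t (\<lambda>y. (semigroup (X i) f y - f y) / X i) x) \<longlonglongrightarrow> semigroup t (L f) x"
  proof (rule integral_dominated_convergence[where w = "\<lambda>_. 2 * c * \<Lambda>"])
    show "AE y in kernel t x. (\<lambda>i. (semigroup (X i) f y - f y) / X i) \<longlonglongrightarrow> L f y"
      unfolding AE_measure_pmf_iff
    proof
      fix y assume "y \<in> set_pmf (kernel t x)"
      then have "y \<in> S" using set_kernel[OF x t] by blast
      from generator_semigroup[OF this f, unfolded tendsto_at_iff_sequentially, rule_format, of X] X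
      show "(\<lambda>i. (semigroup (X i) f y - f y) / X i) \<longlonglongrightarrow> L f y"
        by (simp add: comp_def)
    qed
    show "AE y in kernel t x. norm ((semigroup (X i) f y - f y) / X i) \<le> 2 * c * \<Lambda>" for i
      unfolding AE_measure_pmf_iff
    proof
      fix y assume "y \<in> set_pmf (kernel t x)"
      then have "y \<in> S" using set_kernel[OF x t] by blast
      then show "norm ((semigroup (X i) f y - f y) / X i) \<le> 2 * c * \<Lambda>"
        using semigroup_increment_le[OF _ _ f, of y "X i"] Xpos[of i] by (simp add: field_simps)
    qed
  qed auto
  then show "((\<lambda>h. (semigroup (t + h) f x - semigroup t f x) / h) \<circ> X) \<longlonglongrightarrow> semigroup t (L f) x"
    by (simp add: comp_def eq)
qed

text \<open>
  Dynkin's formula as an inequality.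
\<close>

lemma drift_bound:
  assumes x: "x \<in> S" and T: "0 \<le> T" and f: "\<And>y. \<bar>f y\<bar> \<le> c"
    and drift: "\<And>t. 0 \<le> t \<Longrightarrow> t < T \<Longrightarrow> semigroup t (L f) x \<le> k"
  shows "semigroup T f x \<le> f x + k * T"
  using right_derivative_upper_bound[where \<phi> = "\<lambda>t. semigroup t f x", OF T
      continuous_on_subset[OF continuous_on_semigroup[OF x f]] forward_equation[OF x _ f] drift]
  by (simp add: kernel_0 x)

lemma generator_abs_le:
  assumes x: "x \<in> S" and f: "\<And>y. \<bar>f y\<bar> \<le> c"
  shows "\<bar>L f x\<bar> \<le> 2 * c * \<Lambda>"
proof (rule tendsto_upperbound[OF tendsto_rabs[OF generator_semigroup[OF x f]]])
  show "\<forall>\<^sub>F h in at_right 0. \<bar>(semigroup h f x - f x) / h\<bar> \<le> 2 * c * \<Lambda>"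
    unfolding eventually_at_right_field
  proof (intro exI[of _ 1] conjI allI impI)
    fix h :: real assume "0 < h"
    then show "\<bar>(semigroup h f x - f x) / h\<bar> \<le> 2 * c * \<Lambda>"
      using semigroup_increment_le[OF x _ f, of h] by (simp add: field_simps)
  qed simp
qed simp

lemma semigroup_le_of_superharmonic:
  assumes x: "x \<in> S" and T: "0 \<le> T" and f: "\<And>y. \<bar>f y\<bar> \<le> c" and super: "\<And>y. y \<in> S \<Longrightarrow> L f y \<le> 0"
  shows "semigroup T f x \<le> f x"
proof -
  have "semigroup t (L f) x \<le> 0" if "0 \<le> t" for t
    using super set_kernel[OF x that] by (auto intro!: expectation_pmf_nonpos)
  from drift_bound[OF x T f this] show ?thesis by simp
qed

text \<open>
  The decrease is strict for a short time, and it cannot be undone later.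
\<close>

lemma semigroup_less_of_superharmonic:
  assumes x: "x \<in> S" and f: "\<And>y. \<bar>f y\<bar> \<le> c" and super: "\<And>y. y \<in> S \<Longrightarrow> L f y \<le> 0" and strict: "L f x < 0"
  shows "semigroup 1 f x < f x"
proof -
  have "\<forall>\<^sub>F h in at_right 0. (semigroup h f x - f x) / h < 0"
    using order_tendstoD(2)[OF generator_semigroup[OF x f] strict] .
  then obtain h0 where h0: "h0 > 0" "\<And>h. 0 < h \<Longrightarrow> h < h0 \<Longrightarrow> (semigroup h f x - f x) / h < 0"
    unfolding eventually_at_right_field by auto
  define h where "h = min (h0 / 2) 1"
  have h: "0 < h" "h < h0" "h \<le> 1" using h0(1) by (auto simp: h_def)
  have "semigroup (h + (1 - h)) f x - semigroup h f x \<le> 0"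
    unfolding semigroup_add_diff[OF x less_imp_le[OF h(1)] diff_ge_0_iff_ge[THEN iffD2, OF h(3)] f]
    using semigroup_le_of_superharmonic[OF _ _ f super, of _ "1 - h"] set_kernel[OF x, of h] h
    by (auto intro!: expectation_pmf_nonpos)
  then show ?thesis using h0(2)[OF h(1,2)] h(1) by (simp add: divide_less_0_iff)
qed

text \<open>
  The state occupied at time \<open>s\<close> is also occupied at time \<open>1\<close> with probability at least \<open>exp (- \<Lambda>)\<close>.
  This turns averages over the time interval \<open>[0, 1]\<close> into expectations at its end point, and so lets a
  drift condition on the generator become one on the integer skeleton.
\<close>

lemma semigroup_le_exp_semigroup_1:
  assumes x: "x \<in> S" and s: "0 \<le> s" "s \<le> 1" and f: "\<And>y. 0 \<le> f y" "\<And>y. f y \<le> c"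
  shows "semigroup s f x \<le> exp \<Lambda> * semigroup 1 f x"
proof -
  have fa: "\<bar>f y\<bar> \<le> c" for y using f[of y] by simp
  have c: "0 \<le> c" using f[of x] by linarith
  have low: "exp (- \<Lambda>) * f y \<le> semigroup (1 - s) f y" if y: "y \<in> S" for y
  proof -
    have "exp (- \<Lambda>) * f y \<le> pmf (kernel (1 - s) y) y * f y"
      using stay_prob[OF y, of "1 - s"] rate_nonneg[OF y] s f(1)[of y]
      by (intro mult_right_mono[OF order_trans[of _ "exp (- \<Lambda> * (1 - s))"]]) (auto simp: algebra_simps)
    also have "\<dots> = semigroup (1 - s) (\<lambda>u. indicator {y} u * f y) y"
      by (simp add: pmf.rep_eq)
    also have "\<dots> \<le> semigroup (1 - s) f y"
      by (rule expectation_pmf_mono[where c = c and d = c]) (use f c in \<open>auto simp: indicator_def\<close>)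
    finally show ?thesis .
  qed
  have "exp (- \<Lambda>) * semigroup s f x = semigroup s (\<lambda>y. exp (- \<Lambda>) * f y) x" by simp
  also have "\<dots> \<le> semigroup s (\<lambda>y. semigroup (1 - s) f y) x"
  proof (rule expectation_pmf_mono[where c = "exp (- \<Lambda>) * c" and d = c])
    fix y assume "y \<in> set_pmf (kernel s x)"
    then show "exp (- \<Lambda>) * f y \<le> semigroup (1 - s) f y"
      using low set_kernel[OF x s(1)] by blast
    show "\<bar>exp (- \<Lambda>) * f y\<bar> \<le> exp (- \<Lambda>) * c" using fa by (simp add: abs_mult)
    show "\<bar>semigroup (1 - s) f y\<bar> \<le> c" by (rule abs_expectation_pmf_le) (rule fa)
  qed
  also have "\<dots> = semigroup 1 f x"
    using chapman_kolmogorov[OF x s(1) _ fa, of "1 - s"] s by simp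
  finally show ?thesis by (simp add: exp_minus field_simps)
qed

end

section \<open>Visits between integer times and transience\<close>

context bounded_rate_ctmc
begin

text \<open>
  The form of the Markov property used for events: if every history in \<open>\<Phi>\<close> ends in a state from which
  \<open>y\<close> is reached with probability at least \<open>c\<close>, then the same holds conditionally on \<open>\<Phi>\<close>.
\<close>

lemma markov_prob_ge:
  assumes x: "x \<in> S" and s0: "0 \<le> s 0" and mono: "mono_on {..n} s" and h: "0 \<le> h"
    and step: "\<And>z. \<Phi> z \<Longrightarrow> z n \<in> S \<Longrightarrow> c \<le> pmf (kernel h (z n)) y"
  shows "c * \<P>(w in P x. \<Phi> (past s n w)) \<le> \<P>(w in P x. \<Phi> (past s n w) \<and> Q (s n + h) w = y)"
proof -
  have s: "0 \<le> s k" if "k \<le> n" for k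
    using mono_onD[OF mono, of 0 k] that s0 by simp
  interpret P: prob_space "P x" by (rule prob_space[OF x])
  interpret A: countable_rv "P x" "past s n" "{..n} \<rightarrow>\<^sub>E S" by (rule past_rv[OF x s])
  interpret C: countable_rv "P x" "\<lambda>w. (past s n w, Q (s n + h) w)" "({..n} \<rightarrow>\<^sub>E S) \<times> S"
    by (rule past_next_rv[OF x s h])
  define \<phi> where "\<phi> z = (of_bool (\<Phi> z) :: real)" for z
  have sets: "{w \<in> space (P x). \<Phi> (past s n w)} \<in> sets (P x)"
    using A.sets_rv[of "Collect \<Phi>"] by simp
  have sets': "{w \<in> space (P x). \<Phi> (past s n w) \<and> Q (s n + h) w = y} \<in> sets (P x)"
    using C.sets_rv[of "{(z, u). \<Phi> z \<and> u = y}"] by simp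
  have "\<P>(w in P x. \<Phi> (past s n w) \<and> Q (s n + h) w = y)
      = (\<integral>w. indicator {w \<in> space (P x). \<Phi> (past s n w) \<and> Q (s n + h) w = y} w \<partial>P x)"
    using sets' by simp
  also have "\<dots> = (\<integral>w. \<phi> (past s n w) * indicator {y} (Q (s n + h) w) \<partial>P x)"
    by (rule Bochner_Integration.integral_cong) (auto simp: \<phi>_def indicator_def)
  also have "\<dots> = (\<integral>w. \<phi> (past s n w) * pmf (kernel h (Q (s n) w)) y \<partial>P x)"
    using markov_expectation[OF x s0 mono h, of \<phi> 1 "indicat_real {y}" 1]
    by (simp add: \<phi>_def pmf.rep_eq indicator_def)
  also have "\<dots> \<ge> (\<integral>w. c * indicator {w \<in> space (P x). \<Phi> (past s n w)} w \<partial>P x)"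
  proof (rule integral_mono)
    show "integrable (P x) (\<lambda>w. c * indicator {w \<in> space (P x). \<Phi> (past s n w)} w)"
      using sets by (intro integrable_mult_right integrable_real_indicator) (auto simp: P.emeasure_eq_measure)
    show "integrable (P x) (\<lambda>w. \<phi> (past s n w) * pmf (kernel h (Q (s n) w)) y)"
      using A.integrable_rv[of "\<lambda>z. \<phi> z * pmf (kernel h (z n)) y" 1]
      by (simp add: \<phi>_def pmf_le_1)
    show "c * indicator {w \<in> space (P x). \<Phi> (past s n w)} w \<le> \<phi> (past s n w) * pmf (kernel h (Q (s n) w)) y"
      if "w \<in> space (P x)" for w
      using step[of "past s n w"] Q_in_S[OF x s[OF order_refl] that] by (auto simp: \<phi>_def indicator_def)
  qed
  also have "(\<integral>w. c * indicator {w \<in> space (P x). \<Phi> (past s n w)} w \<partial>P x)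
      = c * \<P>(w in P x. \<Phi> (past s n w))"
    using sets by simp
  finally show ?thesis .
qed

text \<open>
  Decompose by the first grid time at which \<open>y\<close> is visited.  From there, the chain is in \<open>y\<close> at the
  last grid time with probability at least \<open>exp (- \<Lambda> (s n - s 0))\<close>.  The bound does not depend on
  the fineness of the grid.
\<close>

lemma grid_visit_prob:
  fixes s :: "nat \<Rightarrow> real"
  assumes x: "x \<in> S" and y: "y \<in> S" and s0: "0 \<le> s 0" and mono: "mono_on {..n} s"
  shows "exp (- \<Lambda> * (s n - s 0)) * \<P>(w in P x. \<exists>k\<le>n. Q (s k) w = y) \<le> pmf (kernel (s n) x) y"
proof -
  interpret P: prob_space "P x" by (rule prob_space[OF x])
  have s: "s 0 \<le> s k" "0 \<le> s k" "s k \<le> s n" if "k \<le> n" for k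
    using mono_onD[OF mono, of 0 k] mono_onD[OF mono, of k n] that s0 by auto
  define first where "first k \<zeta> \<longleftrightarrow> \<zeta> k = y \<and> (\<forall>i<k. \<zeta> i \<noteq> y)" for k :: nat and \<zeta> :: "nat \<Rightarrow> 's"
  define A where "A k = {w \<in> space (P x). first k (past s k w)}" for k
  define B where "B k = {w \<in> space (P x). first k (past s k w) \<and> Q (s n) w = y}" for k
  have first_past: "first k (past s k w) \<longleftrightarrow> Q (s k) w = y \<and> (\<forall>i<k. Q (s i) w \<noteq> y)" for k w
    by (simp add: first_def)
  have Asets: "A k \<in> sets (P x)" if "k \<le> n" for k
    unfolding A_def
    using countable_rv.sets_rv[OF past_rv[OF x, of k s], of "Collect (first k)"] s that by auto
  have Bsets: "B k \<in> sets (P x)" if "k \<le> n" for k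
  proof -
    have "B k = A k \<inter> {w \<in> space (P x). Q (s n) w \<in> {y}}" by (auto simp: A_def B_def)
    then show ?thesis using Asets[OF that] sets_Q[OF x s(2)[OF order_refl], of "{y}"] by auto
  qed
  have disj: "disjoint_family_on A {..n}" "disjoint_family_on B {..n}"
    unfolding disjoint_family_on_def A_def B_def first_past by (auto, (metis linorder_neqE_nat)+)
  have "{w \<in> space (P x). \<exists>k\<le>n. Q (s k) w = y} = (\<Union>k\<le>n. A k)"
  proof (intro equalityI subsetI)
    fix w assume w: "w \<in> {w \<in> space (P x). \<exists>k\<le>n. Q (s k) w = y}"
    define k where "k = (LEAST k. Q (s k) w = y)"
    obtain k' where k': "k' \<le> n" "Q (s k') w = y" using w by auto
    then have "Q (s k) w = y" "k \<le> n" "\<forall>i<k. Q (s i) w \<noteq> y"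
      unfolding k_def using LeastI[of "\<lambda>k. Q (s k) w = y"] Least_le[of "\<lambda>k. Q (s k) w = y" k']
      by (auto dest: not_less_Least)
    then show "w \<in> (\<Union>k\<le>n. A k)" using w by (auto simp: A_def first_past)
  qed (auto simp: A_def first_past)
  then have "exp (- \<Lambda> * (s n - s 0)) * \<P>(w in P x. \<exists>k\<le>n. Q (s k) w = y)
      = exp (- \<Lambda> * (s n - s 0)) * (\<Sum>k\<le>n. measure (P x) (A k))"
    using P.finite_measure_finite_Union[OF _ _ disj(1)] Asets by auto
  also have "\<dots> = (\<Sum>k\<le>n. exp (- \<Lambda> * (s n - s 0)) * measure (P x) (A k))"
    by (rule sum_distrib_left)
  also have "\<dots> \<le> (\<Sum>k\<le>n. measure (P x) (B k))"
  proof (rule sum_mono)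
    fix k assume "k \<in> {..n}"
    then have k: "k \<le> n" by simp
    have "exp (- \<Lambda> * (s n - s 0)) * \<P>(w in P x. first k (past s k w))
        \<le> \<P>(w in P x. first k (past s k w) \<and> Q (s k + (s n - s k)) w = y)"
    proof (rule markov_prob_ge[OF x, of s, OF s0])
      show "mono_on {..k} s" using mono k by (auto intro: mono_on_subset)
      show "0 \<le> s n - s k" using s[OF k] by simp
      fix z assume "first k z"
      then have "z k = y" by (simp add: first_def)
      moreover have "exp (- \<Lambda> * (s n - s 0)) \<le> exp (- \<Lambda> * (s n - s k))"
        using s[OF k] rate_nonneg[OF x] by (simp add: mult_left_mono)
      ultimately show "exp (- \<Lambda> * (s n - s 0)) \<le> pmf (kernel (s n - s k) (z k)) y"
        using order_trans[OF _ stay_prob[OF y, of "s n - s k"]] s[OF k] by simp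
    qed
    then show "exp (- \<Lambda> * (s n - s 0)) * measure (P x) (A k) \<le> measure (P x) (B k)"
      by (simp add: A_def B_def)
  qed
  also have "\<dots> = measure (P x) (\<Union>k\<le>n. B k)"
    using Bsets by (intro P.finite_measure_finite_Union[OF _ _ disj(2), symmetric]) auto
  also have "\<dots> \<le> measure (P x) {w \<in> space (P x). Q (s n) w \<in> {y}}"
    by (rule P.finite_measure_mono[OF _ sets_Q[OF x s(2)[OF order_refl]]]) (auto simp: B_def)
  also have "\<dots> = pmf (kernel (s n) x) y" using pmf_kernel[OF x s(2)[OF order_refl]] by simp
  finally show ?thesis .
qed

text \<open>
  Right-continuity makes dyadic times sufficient to detect visits, and countably many times keep the
  event measurable.
\<close>

definition dyadic_visit :: "real \<Rightarrow> 's \<Rightarrow> 'w \<Rightarrow> bool" where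
  "dyadic_visit a y w \<longleftrightarrow> (\<exists>m::nat. \<exists>i\<le>2 ^ m. Q (a + real i / 2 ^ m) w = y)"

text \<open>
  The dyadic grids are nested, so the event is an increasing union to which \<open>grid_visit_prob\<close> applies
  level by level.
\<close>

lemma dyadic_visit_prob:
  assumes x: "x \<in> S" and y: "y \<in> S" and a: "0 \<le> a"
  shows "{w \<in> space (P x). dyadic_visit a y w} \<in> sets (P x)"
    and "\<P>(w in P x. dyadic_visit a y w) \<le> exp \<Lambda> * pmf (kernel (a + 1) x) y"
proof -
  interpret P: prob_space "P x" by (rule prob_space[OF x])
  define D where "D m = {w \<in> space (P x). \<exists>i\<le>2 ^ m. Q (a + real i / 2 ^ m) w = y}" for m :: nat
  have D_un: "D m = (\<Union>i\<in>{..2 ^ m}. {w \<in> space (P x). Q (a + real i / 2 ^ m) w \<in> {y}})" for m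
    by (auto simp: D_def)
  have Dsets: "D m \<in> sets (P x)" for m
    unfolding D_un by (intro sets.finite_UN sets_Q[OF x]) (use a in auto)
  have eq: "{w \<in> space (P x). dyadic_visit a y w} = (\<Union>m. D m)"
    by (auto simp: D_def dyadic_visit_def)
  show "{w \<in> space (P x). dyadic_visit a y w} \<in> sets (P x)"
    unfolding eq using Dsets by auto
  have inc: "incseq D"
  proof (rule incseq_SucI, rule subsetI)
    fix m w assume "w \<in> D m"
    then obtain i where i: "w \<in> space (P x)" "i \<le> 2 ^ m" "Q (a + real i / 2 ^ m) w = y"
      by (auto simp: D_def)
    then have "2 * i \<le> 2 ^ Suc m" "Q (a + real (2 * i) / 2 ^ Suc m) w = y" by auto
    then show "w \<in> D (Suc m)" using i(1) unfolding D_def by blast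
  qed
  have bound: "measure (P x) (D m) \<le> exp \<Lambda> * pmf (kernel (a + 1) x) y" for m
  proof -
    have "mono_on {..2 ^ m} (\<lambda>i. a + real i / 2 ^ m)"
      by (rule mono_onI) (auto simp: divide_right_mono)
    from grid_visit_prob[OF x y _ this] show ?thesis
      using a by (simp add: D_def exp_minus field_simps)
  qed
  have "(\<lambda>m. measure (P x) (D m)) \<longlonglongrightarrow> measure (P x) (\<Union>m. D m)"
    by (rule P.finite_Lim_measure_incseq) (use Dsets inc in auto)
  then show "\<P>(w in P x. dyadic_visit a y w) \<le> exp \<Lambda> * pmf (kernel (a + 1) x) y"
    unfolding eq by (rule LIMSEQ_le_const2) (use bound in auto)
qed

lemma visit_imp_dyadic_visit:
  assumes x: "x \<in> S" and w: "w \<in> space (P x)" and a: "0 \<le> a" and t: "a \<le> t" "t < a + 1" and "Q t w = y"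
  shows "dyadic_visit a y w"
proof -
  have "\<forall>\<^sub>F u in at_right t. Q u w = y"
    using right_continuous[OF x w, of t] a t \<open>Q t w = y\<close> by simp
  then obtain v where v: "v > t" "\<And>u. t < u \<Longrightarrow> u < v \<Longrightarrow> Q u w = y"
    unfolding eventually_at_right_field by auto
  \<comment> \<open>\<open>Q\<close> is constant on \<open>[t, v)\<close>; a dyadic time in this interval is also to stay below \<open>a + 1\<close>\<close>
  define \<delta> where "\<delta> = min (v - t) (a + 1 - t)"
  have \<delta>: "\<delta> > 0" using v t by (simp add: \<delta>_def)
  obtain m where m: "inverse 2 ^ m < \<delta>" using real_arch_pow_inv[OF \<delta>, of "inverse 2"] by auto
  define i where "i = nat \<lfloor>(t - a) * 2 ^ m\<rfloor> + 1"
  have pos: "(0::real) < 2 ^ m" by simp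
  have "real i = of_int \<lfloor>(t - a) * 2 ^ m\<rfloor> + 1" using t(1) by (simp add: i_def)
  then have i: "(t - a) * 2 ^ m < real i" "real i \<le> (t - a) * 2 ^ m + 1"
    by linarith+
  have "t - a < real i / 2 ^ m" using i(1) pos by (simp add: pos_less_divide_eq)
  moreover have "real i / 2 ^ m \<le> t - a + inverse 2 ^ m"
    using i(2) pos by (simp add: field_simps power_inverse)
  moreover have "inverse 2 ^ m < v - t" "inverse 2 ^ m < a + 1 - t" using m by (auto simp: \<delta>_def)
  ultimately have *: "t < a + real i / 2 ^ m" "a + real i / 2 ^ m < v" "real i / 2 ^ m < 1"
    by linarith+
  then have "real i < 2 ^ m" using pos by (simp add: field_simps)
  then have "i \<le> 2 ^ m" by (metis less_imp_le of_nat_less_iff of_nat_numeral of_nat_power)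
  with v(2)[OF *(1,2)] show ?thesis unfolding dyadic_visit_def by blast
qed

text \<open>
  By \<open>dyadic_visit_prob\<close> the probabilities of a visit during \<open>[k, k + 1)\<close> are summable; Borel--Cantelli.
\<close>

lemma transient_state_of_summable:
  assumes x: "x \<in> S" and sum: "summable (\<lambda>k. pmf (kernel (real k) x) x)"
  shows "transient_state P Q x"
proof -
  interpret P: prob_space "P x" by (rule prob_space[OF x])
  let ?B = "\<lambda>k::nat. {w \<in> space (P x). dyadic_visit (real k) x w}"
  have "summable (\<lambda>k. exp \<Lambda> * pmf (kernel (real (Suc k)) x) x)"
    by (intro summable_mult) (subst summable_Suc_iff, rule sum)
  then have "summable (\<lambda>k. measure (P x) (?B k))"
    by (rule summable_comparison_test'[where N = 0])
       (use dyadic_visit_prob(2)[OF x x of_nat_0_le_iff] in \<open>simp add: add.commute\<close>)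
  then have "AE w in P x. \<forall>\<^sub>F k in sequentially. w \<in> space (P x) - ?B k"
    using dyadic_visit_prob(1)[OF x x] by (intro borel_cantelli_AE1) (auto simp: P.emeasure_eq_measure)
  then show ?thesis
    unfolding transient_state_def
  proof (eventually_elim)
    case (elim w)
    then obtain K where K: "\<And>k. k \<ge> K \<Longrightarrow> w \<in> space (P x) - ?B k"
      by (auto simp: eventually_sequentially)
    have "{t. 0 \<le> t \<and> Q t w = x} \<subseteq> {0..real K}"
    proof
      fix t assume "t \<in> {t. 0 \<le> t \<and> Q t w = x}"
      then have t: "0 \<le> t" "Q t w = x" by auto
      have "t \<le> real K"
      proof (rule ccontr)
        assume "\<not> t \<le> real K"
        define k where "k = nat \<lfloor>t\<rfloor>"
        have k: "real k \<le> t" "t < real k + 1" using t(1) by (auto simp: k_def)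
        then have "K \<le> k" using \<open>\<not> t \<le> real K\<close> by linarith
        from K[OF this] visit_imp_dyadic_visit[OF x _ _ k t(2)] show False by auto
      qed
      then show "t \<in> {0..real K}" using t by simp
    qed
    then show ?case by (rule bounded_subset[rotated]) simp
  qed
qed

text \<open>
  Each visit to \<open>z\<close> at an integer time lowers the expectation of \<open>g\<close> by at least \<open>d\<close>, and it can only be lowered
  by \<open>2 c\<close> in total.  Hence \<open>\<Sum>k. p\<^sub>k(x,z)\<close> converges.  Since a visit to \<open>x\<close>
  at an integer time is followed one time unit later by a visit to \<open>z\<close> with a fixed positive probability, \<open>\<Sum>k. p\<^sub>k(x,x)\<close> converges as well.
\<close>

lemma transience_criterion:
  assumes x: "x \<in> S" and z: "z \<in> S" and g: "\<And>y. \<bar>g y\<bar> \<le> c"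
    and super: "\<And>y. y \<in> S \<Longrightarrow> L g y \<le> 0" and strict: "L g z < 0" and reach: "pmf (kernel 1 x) z > 0"
  shows "transient_state P Q x"
proof (rule transient_state_of_summable[OF x])
  have sg: "\<bar>semigroup t g y\<bar> \<le> c" for t y
    by (rule abs_expectation_pmf_le) (rule g)
  define d where "d = g z - semigroup 1 g z"
  have d: "d > 0" unfolding d_def using semigroup_less_of_superharmonic[OF z g super strict] by simp
  have step: "d * pmf (kernel (real k) x) z \<le> semigroup (real k) g x - semigroup (real (Suc k)) g x" for k
  proof -
    have "d * pmf (kernel (real k) x) z = semigroup (real k) (\<lambda>y. d * indicator {z} y) x"
      by (simp add: pmf.rep_eq)
    also have "\<dots> \<le> semigroup (real k) (\<lambda>y. g y - semigroup 1 g y) x"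
    proof (rule expectation_pmf_mono[where c = d and d = "2 * c"])
      fix y assume "y \<in> set_pmf (kernel (real k) x)"
      then have y: "y \<in> S" using set_kernel[OF x, of "real k"] by auto
      show "\<bar>d * indicator {z} y\<bar> \<le> d" using d by (auto simp: indicator_def)
      show "\<bar>g y - semigroup 1 g y\<bar> \<le> 2 * c"
        using g[of y] sg[of 1 y] by linarith
      show "d * indicator {z} y \<le> g y - semigroup 1 g y"
        using semigroup_le_of_superharmonic[OF y _ g super, of 1] by (auto simp: d_def indicator_def)
    qed
    also have "\<dots> = - semigroup (real k) (\<lambda>y. semigroup 1 g y - g y) x"
      by (subst integral_minus[symmetric]) simp
    also have "\<dots> = semigroup (real k) g x - semigroup (real (Suc k)) g x"
      using semigroup_add_diff[OF x, of "real k" 1 g c] g by (simp add: add.commute)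
    finally show ?thesis .
  qed
  let ?r = "pmf (kernel 1 x) z"
  have "(\<Sum>k<n. pmf (kernel (real k) x) x) \<le> (2 * c / d + 1) / ?r" for n
  proof -
    have "d * (\<Sum>k<m. pmf (kernel (real k) x) z) \<le> g x - semigroup (real m) g x" for m
    proof (induction m)
      case (Suc m)
      then show ?case using step[of m] by (simp add: distrib_left)
    qed (simp add: kernel_0[OF x])
    from this[of "Suc n"] have "d * (\<Sum>k<Suc n. pmf (kernel (real k) x) z) \<le> 2 * c"
      using g[of x] sg[of "real (Suc n)" x] by linarith
    then have total: "(\<Sum>k<Suc n. pmf (kernel (real k) x) z) \<le> 2 * c / d" using d by (simp add: field_simps)
    have "?r * (\<Sum>k<n. pmf (kernel (real k) x) x) = (\<Sum>k<n. pmf (kernel (real k) x) x * ?r)"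
      by (simp add: sum_distrib_left mult.commute)
    also have "\<dots> \<le> (\<Sum>k<n. pmf (kernel (real (Suc k)) x) z)"
      using kernel_add_ge[OF x, of "real k" 1 x z for k] by (intro sum_mono) (simp add: add.commute)
    also have "\<dots> \<le> (\<Sum>k<Suc n. pmf (kernel (real k) x) z)"
      by (subst sum.lessThan_Suc_shift) simp
    finally show ?thesis using total reach by (simp add: field_simps)
  qed
  then show "summable (\<lambda>k. pmf (kernel (real k) x) x)"
    by (intro summableI_nonneg_bounded[of _ "(2 * c / d + 1) / ?r"]) auto
qed

end

section \<open>A drift criterion for positive recurrence\<close>

text \<open>
  The event that a certified return to \<open>x\<close> has not yet happened between times \<open>m\<close> and \<open>n\<close>.  Asking for a
  step from a second state \<open>z\<close> into \<open>x\<close>, rather than for a visit to \<open>x\<close>, ensures that the chain has jumped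
  before; with general \<open>m\<close>, one notion serves both for the mean return time and for recurrence.
\<close>

definition avoids_step :: "'a \<Rightarrow> 'a \<Rightarrow> nat \<Rightarrow> nat \<Rightarrow> (nat \<Rightarrow> 'a) \<Rightarrow> bool" where
  "avoids_step z x m n \<zeta> \<longleftrightarrow> (\<forall>j. m \<le> j \<and> j < n \<longrightarrow> \<not> (\<zeta> j = z \<and> \<zeta> (Suc j) = x))"

lemma avoids_step_mono: "n \<le> k \<Longrightarrow> avoids_step z x m k \<zeta> \<Longrightarrow> avoids_step z x m n \<zeta>"
  by (auto simp: avoids_step_def)

lemma sum_diff_shift3_le:
  fixes a :: "nat \<Rightarrow> real"
  assumes "\<And>n. 0 \<le> a n" "\<And>n. a n \<le> 1"
  shows "(\<Sum>n<K. a n - a (n + 3)) \<le> 3"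
proof -
  have "(\<Sum>n<K. a n - a (n + 3)) = a 0 + a 1 + a 2 - (a K + a (K + 1) + a (K + 2))"
    by (induction K) (simp_all add: numeral_eq_Suc)
  then show ?thesis using assms(1)[of K] assms(1)[of "K+1"] assms(1)[of "K+2"] assms(2)[of 0] assms(2)[of 1] assms(2)[of 2]
    by linarith
qed

context bounded_rate_ctmc
begin

lemma avoids_step_past [simp]:
  "n \<le> k \<Longrightarrow> avoids_step z x m n (past s k w) \<longleftrightarrow> avoids_step z x m n (\<lambda>j. Q (s j) w)"
  by (auto simp: avoids_step_def)

text \<open>
  The drift \<open>w - 1\<close> of the generator becomes the drift \<open>exp \<Lambda> * semigroup 1 w - 1\<close> of the skeleton: the
  time average of \<open>w\<close> over \<open>[0, 1]\<close> is replaced by its expectation at time \<open>1\<close> with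
  \<open>semigroup_le_exp_semigroup_1\<close>.
\<close>

lemma skeleton_drift:
  assumes y: "y \<in> S" and V: "\<And>u. 0 \<le> V u" "\<And>u. V u \<le> M"
    and w: "\<And>u. 0 \<le> w u" "\<And>u. w u \<le> d"
    and drift: "\<And>u. u \<in> S \<Longrightarrow> L V u \<le> w u - 1"
  shows "semigroup 1 V y \<le> V y - 1 + exp \<Lambda> * semigroup 1 w y"
proof -
  have Va: "\<bar>V u\<bar> \<le> M" for u using V[of u] by simp
  have wa: "\<bar>w u\<bar> \<le> d" for u using w[of u] by simp
  have "semigroup t (L V) y \<le> exp \<Lambda> * semigroup 1 w y - 1" if t: "0 \<le> t" "t < 1" for t
  proof -
    have "semigroup t (L V) y \<le> semigroup t (\<lambda>u. w u - 1) y"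
    proof (rule expectation_pmf_mono[where c = "2 * M * \<Lambda>" and d = "d + 1"])
      fix u assume "u \<in> set_pmf (kernel t y)"
      then have u: "u \<in> S" using set_kernel[OF y t(1)] by blast
      show "\<bar>L V u\<bar> \<le> 2 * M * \<Lambda>" by (rule generator_abs_le[OF u Va])
      show "\<bar>w u - 1\<bar> \<le> d + 1" using w[of u] by linarith
      show "L V u \<le> w u - 1" by (rule drift[OF u])
    qed
    also have "\<dots> = semigroup t w y - 1"
      using integrable_pmf_bounded[of "kernel t y" w d] wa by simp
    also have "semigroup t w y \<le> exp \<Lambda> * semigroup 1 w y"
      by (rule semigroup_le_exp_semigroup_1[OF y _ _ w]) (use t in auto)
    finally show ?thesis by simp
  qed
  from drift_bound[OF y _ Va this, of 1] show ?thesis by simp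
qed

text \<open>
  Foster's criterion in a form that applies the generator to bounded functions only.  At states with
  \<open>V u \<ge> M\<close> the truncated function is at its maximum, where its drift is at most \<open>0\<close> but need not be negative;
  this is the role of the first indicator in the drift condition.
\<close>

context
  fixes V :: "'s \<Rightarrow> real" and F :: "'s set" and b :: real and x z :: 's
  assumes V: "\<And>u. 0 \<le> V u" and b: "0 \<le> b"
    and drift: "\<And>M u. 0 \<le> M \<Longrightarrow> u \<in> S \<Longrightarrow>
      L (\<lambda>q. min (V q) M) u \<le> of_bool (V u \<ge> M) + b * of_bool (u \<in> F) - 1"
    and F: "finite F" and x: "x \<in> S" and z: "z \<in> S" and xz: "x \<noteq> z"
    and Fz: "\<And>y. y \<in> F \<Longrightarrow> pmf (kernel 1 y) z > 0" and zx: "pmf (kernel 1 z) x > 0"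
begin

abbreviation avoid :: "nat \<Rightarrow> nat \<Rightarrow> 'w \<Rightarrow> bool" where
  "avoid m n w \<equiv> avoids_step z x m n (\<lambda>j. Q (real j) w)"

lemma sets_past: "{w \<in> space (P x). \<Phi> (past real n w)} \<in> sets (P x)"
  using countable_rv.sets_rv[OF past_rv[OF x, of n real], of "Collect \<Phi>"] by simp

lemma sets_avoid: "{w \<in> space (P x). avoid m n w} \<in> sets (P x)"
  using sets_past[of "avoids_step z x m n" n] by simp

text \<open>
  From \<open>F\<close> the chain moves to \<open>z\<close> and then to \<open>x\<close> in two time units with probability at least \<open>c\<close>, uniformly
  because \<open>F\<close> is finite.  The right-hand side telescopes over \<open>n\<close>, which bounds the expected number of
  visits to \<open>F\<close> before the step.  The condition \<open>m \<le> n + 2\<close> says that the step from \<open>z\<close> to \<open>x\<close>, which starts at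
  time \<open>n + 2\<close>, is late enough to count.
\<close>

lemma exit_from_F:
  obtains c where "c > 0"
    "\<And>m n. m \<le> n + 2 \<Longrightarrow> c * \<P>(w in P x. avoid m n w \<and> Q (real (Suc n)) w \<in> F)
      \<le> \<P>(w in P x. avoid m n w) - \<P>(w in P x. avoid m (n + 3) w)"
proof -
  interpret P: prob_space "P x" by (rule prob_space[OF x])
  define c1 where "c1 = Min (insert 1 ((\<lambda>y. pmf (kernel 1 y) z) ` F))"
  have c1: "c1 > 0" "\<And>y. y \<in> F \<Longrightarrow> c1 \<le> pmf (kernel 1 y) z"
    unfolding c1_def using F Fz by auto
  define c where "c = c1 * pmf (kernel 1 z) x"
  have "c * \<P>(w in P x. avoid m n w \<and> Q (real (Suc n)) w \<in> F)
      \<le> \<P>(w in P x. avoid m n w) - \<P>(w in P x. avoid m (n + 3) w)" if mn: "m \<le> n + 2" for m n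
  proof -
    have mono: "mono_on A real" for A by (auto intro: mono_onI)
    let ?\<Phi> = "\<lambda>\<zeta>. avoids_step z x m n \<zeta> \<and> \<zeta> (Suc n) \<in> F"
    let ?\<Phi>' = "\<lambda>\<zeta>. avoids_step z x m n \<zeta> \<and> \<zeta> (Suc n) \<in> F \<and> \<zeta> (n + 2) = z"
    have "c1 * \<P>(w in P x. ?\<Phi> (past real (Suc n) w))
        \<le> \<P>(w in P x. ?\<Phi> (past real (Suc n) w) \<and> Q (real (Suc n) + 1) w = z)"
      by (rule markov_prob_ge[OF x, of real]) (use mono c1 in auto)
    then have 1: "c1 * \<P>(w in P x. avoid m n w \<and> Q (real (Suc n)) w \<in> F)
        \<le> \<P>(w in P x. avoid m n w \<and> Q (real (Suc n)) w \<in> F \<and> Q (real (n + 2)) w = z)"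
      by (simp add: conj_assoc add.commute)
    have "pmf (kernel 1 z) x * \<P>(w in P x. ?\<Phi>' (past real (n + 2) w))
        \<le> \<P>(w in P x. ?\<Phi>' (past real (n + 2) w) \<and> Q (real (n + 2) + 1) w = x)"
      by (rule markov_prob_ge[OF x, of real]) (use mono in auto)
    then have 2: "pmf (kernel 1 z) x
          * \<P>(w in P x. avoid m n w \<and> Q (real (Suc n)) w \<in> F \<and> Q (real (n + 2)) w = z)
        \<le> \<P>(w in P x. avoid m n w \<and> Q (real (Suc n)) w \<in> F \<and> Q (real (n + 2)) w = z
              \<and> Q (real (n + 3)) w = x)"
      by (simp add: conj_assoc add.commute)
    have "c * \<P>(w in P x. avoid m n w \<and> Q (real (Suc n)) w \<in> F)
        \<le> pmf (kernel 1 z) x * \<P>(w in P x. avoid m n w \<and> Q (real (Suc n)) w \<in> F \<and> Q (real (n + 2)) w = z)"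
      using mult_left_mono[OF 1, of "pmf (kernel 1 z) x"] by (simp add: c_def mult_ac)
    also note 2
    also have "\<P>(w in P x. avoid m n w \<and> Q (real (Suc n)) w \<in> F \<and> Q (real (n + 2)) w = z
              \<and> Q (real (n + 3)) w = x)
        \<le> measure (P x) ({w \<in> space (P x). avoid m n w} - {w \<in> space (P x). avoid m (n + 3) w})"
    proof (rule P.finite_measure_mono)
      show "{w \<in> space (P x). avoid m n w \<and> Q (real (Suc n)) w \<in> F \<and> Q (real (n + 2)) w = z
            \<and> Q (real (n + 3)) w = x}
          \<subseteq> {w \<in> space (P x). avoid m n w} - {w \<in> space (P x). avoid m (n + 3) w}"
      proof
        fix w
        assume w: "w \<in> {w \<in> space (P x). avoid m n w \<and> Q (real (Suc n)) w \<in> F \<and> Q (real (n + 2)) w = z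
            \<and> Q (real (n + 3)) w = x}"
        have "Suc (n + 2) = n + 3" by simp
        then have "\<not> avoid m (n + 3) w"
          using w mn unfolding avoids_step_def by (metis (mono_tags, lifting) lessI mem_Collect_eq)
        then show "w \<in> {w \<in> space (P x). avoid m n w} - {w \<in> space (P x). avoid m (n + 3) w}"
          using w by simp
      qed
    qed (use sets_avoid in auto)
    also have "\<dots> = \<P>(w in P x. avoid m n w) - \<P>(w in P x. avoid m (n + 3) w)"
      by (rule P.finite_measure_Diff) (use sets_avoid in \<open>auto intro: avoids_step_mono[of n "n + 3"]\<close>)
    finally show ?thesis .
  qed
  moreover have "c > 0" using c1 zx by (simp add: c_def)
  ultimately show ?thesis using that by blast
qed

text \<open>
  One step of Foster's argument for the process killed at the step from \<open>z\<close> to \<open>x\<close>: a surviving path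
  loses one unit of energy, except for the compensation of visits to \<open>F\<close> and of truncation.
\<close>

lemma avoid_drift:
  assumes M: "0 \<le> M"
  defines "VM \<equiv> \<lambda>q. min (V q) M"
  shows "(\<integral>w. of_bool (avoid m (Suc n) w) * VM (Q (real (Suc n)) w) \<partial>P x)
    \<le> (\<integral>w. of_bool (avoid m n w) * VM (Q (real n) w) \<partial>P x) - \<P>(w in P x. avoid m n w)
      + exp \<Lambda> * (\<P>(w in P x. V (Q (real (Suc n)) w) \<ge> M)
                 + b * \<P>(w in P x. avoid m n w \<and> Q (real (Suc n)) w \<in> F))"
proof -
  interpret P: prob_space "P x" by (rule prob_space[OF x])
  interpret T: countable_rv "P x" "past real (Suc n)" "{..Suc n} \<rightarrow>\<^sub>E S" by (rule past_rv[OF x]) simp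
  define u where "u q = of_bool (V q \<ge> M) + b * of_bool (q \<in> F)" for q
  define \<phi> where "\<phi> \<zeta> = (of_bool (avoids_step z x m n \<zeta>) :: real)" for \<zeta>
  have \<phi>: "\<bar>\<phi> \<zeta>\<bar> \<le> 1" "0 \<le> \<phi> \<zeta>" for \<zeta> by (auto simp: \<phi>_def)
  have \<phi>_past: "\<phi> (past real k w) = of_bool (avoid m n w)" if "n \<le> k" for k w
    using that by (simp add: \<phi>_def)
  have VM: "0 \<le> VM q" "VM q \<le> M" "\<bar>VM q\<bar> \<le> M" for q using V[of q] M by (auto simp: VM_def)
  have u: "0 \<le> u q" "u q \<le> 1 + b" "\<bar>u q\<bar> \<le> 1 + b" for q using b by (auto simp: u_def)
  have sVM: "\<bar>semigroup 1 VM q\<bar> \<le> M" for q by (rule abs_expectation_pmf_le) (rule VM)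
  have su: "\<bar>semigroup 1 u q\<bar> \<le> 1 + b" for q by (rule abs_expectation_pmf_le) (rule u)
  have mono: "mono_on A real" for A by (auto intro: mono_onI)
  have bd: "\<bar>\<phi> \<zeta> * r\<bar> \<le> k" if "\<bar>r\<bar> \<le> k" for \<zeta> r k
    using that order_trans[OF abs_ge_zero that] by (auto simp: \<phi>_def)
  have int: "integrable (P x) (\<lambda>w. of_bool (avoid m n w) * f (past real (Suc n) w))"
    if "\<And>\<zeta>. \<bar>f \<zeta>\<bar> \<le> k" for f :: "(nat \<Rightarrow> 's) \<Rightarrow> real" and k
    using T.integrable_rv[of "\<lambda>\<zeta>. \<phi> \<zeta> * f \<zeta>" k] bd that by (simp add: \<phi>_past)
  have next_step: "(\<integral>w. of_bool (avoid m n w) * f (Q (real (Suc n)) w) \<partial>P x)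
      = (\<integral>w. of_bool (avoid m n w) * semigroup 1 f (Q (real n) w) \<partial>P x)" if "\<And>q. \<bar>f q\<bar> \<le> k" for f :: "'s \<Rightarrow> real" and k
    using markov_expectation[where s = real and n = n and h = 1 and \<phi> = \<phi> and c = 1 and f = f and d = k, OF x _ mono] \<phi> that
    by (simp add: \<phi>_past add.commute)
  have iVM: "integrable (P x) (\<lambda>w. of_bool (avoid m n w) * VM (Q (real (Suc n)) w))"
    using int[of "\<lambda>\<zeta>. VM (\<zeta> (Suc n))" M] VM by simp
  have iVM': "integrable (P x) (\<lambda>w. of_bool (avoid m n w) * VM (Q (real n) w))"
    using int[of "\<lambda>\<zeta>. VM (\<zeta> n)" M] VM by simp
  have iVM'': "integrable (P x) (\<lambda>w. of_bool (avoid m (Suc n) w) * VM (Q (real (Suc n)) w))"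
    using T.integrable_rv[of "\<lambda>\<zeta>. of_bool (avoids_step z x m (Suc n) \<zeta>) * VM (\<zeta> (Suc n))" M] VM M
    by (simp add: abs_mult)
  have isVM: "integrable (P x) (\<lambda>w. of_bool (avoid m n w) * semigroup 1 VM (Q (real n) w))"
    using int[of "\<lambda>\<zeta>. semigroup 1 VM (\<zeta> n)" M] sVM by simp
  have isu: "integrable (P x) (\<lambda>w. of_bool (avoid m n w) * semigroup 1 u (Q (real n) w))"
    using int[of "\<lambda>\<zeta>. semigroup 1 u (\<zeta> n)" "1 + b"] su by simp
  have iu: "integrable (P x) (\<lambda>w. of_bool (avoid m n w) * u (Q (real (Suc n)) w))"
    using int[of "\<lambda>\<zeta>. u (\<zeta> (Suc n))" "1 + b"] u by simp
  have iav: "integrable (P x) (\<lambda>w. of_bool (avoid m n w) :: real)"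
    using int[of "\<lambda>_. 1" 1] by simp
  have prob: "\<P>(w in P x. \<Phi> w) = (\<integral>w. of_bool (\<Phi> w) \<partial>P x)" if "{w \<in> space (P x). \<Phi> w} \<in> sets (P x)" for \<Phi>
  proof -
    have "\<P>(w in P x. \<Phi> w) = (\<integral>w. indicator {w \<in> space (P x). \<Phi> w} w \<partial>P x)" using that by simp
    also have "\<dots> = (\<integral>w. of_bool (\<Phi> w) \<partial>P x)"
      by (rule Bochner_Integration.integral_cong) (auto simp: indicator_def)
    finally show ?thesis .
  qed
  have "(\<integral>w. of_bool (avoid m (Suc n) w) * VM (Q (real (Suc n)) w) \<partial>P x)
      \<le> (\<integral>w. of_bool (avoid m n w) * VM (Q (real (Suc n)) w) \<partial>P x)"
    by (rule integral_mono[OF iVM'' iVM])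
       (use VM avoids_step_mono[of n "Suc n" z x m] in auto)
  also have "\<dots> = (\<integral>w. of_bool (avoid m n w) * semigroup 1 VM (Q (real n) w) \<partial>P x)"
    by (rule next_step[OF VM(3)])
  also have "\<dots> \<le> (\<integral>w. of_bool (avoid m n w) * VM (Q (real n) w) - of_bool (avoid m n w)
        + exp \<Lambda> * (of_bool (avoid m n w) * semigroup 1 u (Q (real n) w)) \<partial>P x)"
  proof (rule integral_mono[OF isVM])
    show "integrable (P x) (\<lambda>w. of_bool (avoid m n w) * VM (Q (real n) w) - of_bool (avoid m n w)
        + exp \<Lambda> * (of_bool (avoid m n w) * semigroup 1 u (Q (real n) w)))"
      using iVM' iav isu by auto
    fix w assume "w \<in> space (P x)"
    then have "Q (real n) w \<in> S" using Q_in_S[OF x] by simp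
    then have "semigroup 1 VM (Q (real n) w) \<le> VM (Q (real n) w) - 1 + exp \<Lambda> * semigroup 1 u (Q (real n) w)"
    proof (rule skeleton_drift[where V = VM and w = u, OF _ VM(1,2) u(1,2)])
      show "L VM q \<le> u q - 1" if "q \<in> S" for q
        using drift[OF M that] by (simp add: u_def VM_def)
    qed
    then show "of_bool (avoid m n w) * semigroup 1 VM (Q (real n) w)
        \<le> of_bool (avoid m n w) * VM (Q (real n) w) - of_bool (avoid m n w)
        + exp \<Lambda> * (of_bool (avoid m n w) * semigroup 1 u (Q (real n) w))"
      by (cases "avoid m n w") auto
  qed
  also have "\<dots> = (\<integral>w. of_bool (avoid m n w) * VM (Q (real n) w) \<partial>P x) - \<P>(w in P x. avoid m n w)
        + exp \<Lambda> * (\<integral>w. of_bool (avoid m n w) * u (Q (real (Suc n)) w) \<partial>P x)"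
    using iVM' iav isu by (simp add: prob[OF sets_avoid] next_step[of u, OF u(3)] del: of_nat_Suc)
  also have "(\<integral>w. of_bool (avoid m n w) * u (Q (real (Suc n)) w) \<partial>P x)
      \<le> \<P>(w in P x. V (Q (real (Suc n)) w) \<ge> M) + b * \<P>(w in P x. avoid m n w \<and> Q (real (Suc n)) w \<in> F)"
  proof -
    have m1: "{w \<in> space (P x). V (Q (real (Suc n)) w) \<ge> M} \<in> sets (P x)"
      using sets_past[of "\<lambda>\<zeta>. V (\<zeta> (Suc n)) \<ge> M" "Suc n"] by simp
    have m2: "{w \<in> space (P x). avoid m n w \<and> Q (real (Suc n)) w \<in> F} \<in> sets (P x)"
      using sets_past[of "\<lambda>\<zeta>. avoids_step z x m n \<zeta> \<and> \<zeta> (Suc n) \<in> F" "Suc n"] by simp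
    have i1: "integrable (P x) (\<lambda>w. of_bool (V (Q (real (Suc n)) w) \<ge> M) :: real)"
      using T.integrable_rv[of "\<lambda>\<zeta>. of_bool (V (\<zeta> (Suc n)) \<ge> M)" 1] by simp
    have i2: "integrable (P x) (\<lambda>w. of_bool (avoid m n w \<and> Q (real (Suc n)) w \<in> F) :: real)"
      using T.integrable_rv[of "\<lambda>\<zeta>. of_bool (avoids_step z x m n \<zeta> \<and> \<zeta> (Suc n) \<in> F)" 1] by simp
    have "(\<integral>w. of_bool (avoid m n w) * u (Q (real (Suc n)) w) \<partial>P x)
        \<le> (\<integral>w. of_bool (V (Q (real (Suc n)) w) \<ge> M)
             + b * of_bool (avoid m n w \<and> Q (real (Suc n)) w \<in> F) \<partial>P x)"
    proof (rule integral_mono[OF iu])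
      show "integrable (P x) (\<lambda>w. of_bool (V (Q (real (Suc n)) w) \<ge> M)
             + b * of_bool (avoid m n w \<and> Q (real (Suc n)) w \<in> F))"
        using i1 i2 by (intro Bochner_Integration.integrable_add integrable_mult_right)
      show "of_bool (avoid m n w) * u (Q (real (Suc n)) w)
          \<le> of_bool (V (Q (real (Suc n)) w) \<ge> M) + b * of_bool (avoid m n w \<and> Q (real (Suc n)) w \<in> F)" for w
        using b by (auto simp: u_def)
    qed
    also have "\<dots> = \<P>(w in P x. V (Q (real (Suc n)) w) \<ge> M)
        + b * \<P>(w in P x. avoid m n w \<and> Q (real (Suc n)) w \<in> F)"
      unfolding prob[OF m1] prob[OF m2] using i1 i2
      by (subst Bochner_Integration.integral_add) auto
    finally show ?thesis .
  qed
  finally show ?thesis by simp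
qed

text \<open>
  Adding \<open>avoid_drift\<close> over \<open>n < K\<close> bounds the partial sums by the initial energy, the visits to \<open>F\<close> and
  a truncation term.  The first two do not depend on \<open>K\<close> or on the level \<open>M\<close>, and for fixed \<open>K\<close> the last one
  vanishes as \<open>M \<rightarrow> \<infinity>\<close>.
\<close>

lemma summable_avoid: "summable (\<lambda>n. \<P>(w in P x. avoid m n w))"
proof -
  interpret P: prob_space "P x" by (rule prob_space[OF x])
  obtain c where c: "c > 0" and exit:
    "\<And>m n. m \<le> n + 2 \<Longrightarrow> c * \<P>(w in P x. avoid m n w \<and> Q (real (Suc n)) w \<in> F)
      \<le> \<P>(w in P x. avoid m n w) - \<P>(w in P x. avoid m (n + 3) w)"
    using exit_from_F by blast
  define a where "a n = \<P>(w in P x. avoid m n w)" for n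
  define f where "f n = \<P>(w in P x. avoid m n w \<and> Q (real (Suc n)) w \<in> F)" for n
  define tail where "tail M n = \<P>(w in P x. V (Q (real (Suc n)) w) \<ge> M)" for M n
  have a01: "0 \<le> a n" "a n \<le> 1" for n by (auto simp: a_def)
  have a_anti: "a (n + 3) \<le> a n" for n
    unfolding a_def by (rule P.finite_measure_mono[OF _ sets_avoid])
      (auto intro: avoids_step_mono[of n "n + 3"])
  \<comment> \<open>for the \<open>n\<close> with \<open>n + 2 < m\<close> no step counts yet, and the probability is just bounded by \<open>1\<close>\<close>
  have f_le: "f n \<le> (a n - a (n + 3)) / c + of_bool (n < m)" for n
  proof (cases "m \<le> n + 2")
    case True
    then have "f n \<le> (a n - a (n + 3)) / c" using exit[OF True] c by (simp add: f_def a_def field_simps)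
    then show ?thesis by (simp add: order_trans)
  next
    case False
    have "f n \<le> 1" by (simp add: f_def)
    moreover have "0 \<le> (a n - a (n + 3)) / c" using a_anti[of n] c by simp
    ultimately show ?thesis using False by simp
  qed
  define C where "C = V x + exp \<Lambda> * (b * (3 / c + real m))"
  have bound: "(\<Sum>n<K. a n) \<le> C + exp \<Lambda> * (\<Sum>n<K. tail M n)" if M: "0 \<le> M" for K M
  proof -
    define v where "v n = (\<integral>w. of_bool (avoid m n w) * min (V (Q (real n) w)) M \<partial>P x)" for n
    have v0: "v 0 \<le> V x"
    proof -
      have "v 0 = (\<integral>w. min (V (Q 0 w)) M \<partial>P x)" by (simp add: v_def avoids_step_def)
      also have "\<dots> = semigroup 0 (\<lambda>q. min (V q) M) x" by (simp add: expectation_kernel x)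
      finally show ?thesis by (simp add: kernel_0[OF x])
    qed
    have vK: "0 \<le> v K"
      unfolding v_def using V M by (intro Bochner_Integration.integral_nonneg) auto
    have total: "(\<Sum>n<K. a n) \<le> v 0 - v K + exp \<Lambda> * ((\<Sum>n<K. tail M n) + b * (\<Sum>n<K. f n))"
    proof (induction K)
      case (Suc K)
      have "v (Suc K) \<le> v K - a K + exp \<Lambda> * (tail M K + b * f K)"
        unfolding v_def a_def f_def tail_def by (rule avoid_drift[OF M])
      with Suc show ?case by (simp add: algebra_simps)
    qed simp
    have "(\<Sum>n<K. f n) \<le> 3 / c + real m"
    proof -
      have "(\<Sum>n<K. f n) \<le> (\<Sum>n<K. (a n - a (n + 3)) / c + of_bool (n < m))"
        by (rule sum_mono) (rule f_le)
      also have "\<dots> = (\<Sum>n<K. a n - a (n + 3)) / c + (\<Sum>n<K. of_bool (n < m))"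
        by (simp add: sum.distrib sum_divide_distrib)
      also have "(\<Sum>n<K. a n - a (n + 3)) \<le> 3" by (rule sum_diff_shift3_le) (rule a01)+
      also have "(\<Sum>n<K. of_bool (n < m)) \<le> real m"
      proof -
        have "(\<Sum>n<K. of_bool (n < m)) = real (card ({..<K} \<inter> {n. n < m}))"
          by simp
        also have "\<dots> \<le> real (card {..<m})"
          by (intro of_nat_mono card_mono) auto
        finally show ?thesis by simp
      qed
      finally show ?thesis using c by (simp add: divide_right_mono)
    qed
    then have "exp \<Lambda> * ((\<Sum>n<K. tail M n) + b * (\<Sum>n<K. f n))
        \<le> exp \<Lambda> * ((\<Sum>n<K. tail M n) + b * (3 / c + real m))"
      using b by (intro mult_left_mono add_left_mono) auto
    with total v0 vK show ?thesis unfolding C_def distrib_left[of "exp \<Lambda>"] by linarith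
  qed
  have tail0: "(\<lambda>i. tail (real i) n) \<longlonglongrightarrow> 0" for n
  proof -
    let ?A = "\<lambda>i::nat. {w \<in> space (P x). V (Q (real (Suc n)) w) \<ge> real i}"
    have "(\<lambda>i. measure (P x) (?A i)) \<longlonglongrightarrow> measure (P x) (\<Inter>i. ?A i)"
    proof (rule P.finite_Lim_measure_decseq)
      show "range ?A \<subseteq> sets (P x)"
        using sets_past[of "\<lambda>\<zeta>. V (\<zeta> (Suc n)) \<ge> real i" "Suc n" for i] by auto
      show "decseq ?A" by (rule decseq_SucI) auto
    qed
    moreover have "(\<Inter>i. ?A i) = {}"
    proof -
      have "\<exists>i::nat. \<not> V (Q (real (Suc n)) w) \<ge> real i" for w
        using reals_Archimedean2[of "V (Q (real (Suc n)) w)"] by (auto simp: not_le)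
      then show ?thesis by blast
    qed
    ultimately show ?thesis by (simp add: tail_def)
  qed
  have "(\<Sum>n<K. a n) \<le> C" for K
  proof -
    have "(\<lambda>i. C + exp \<Lambda> * (\<Sum>n<K. tail (real i) n)) \<longlonglongrightarrow> C + exp \<Lambda> * (\<Sum>n<K. 0)"
      by (intro tendsto_intros tail0)
    from LIMSEQ_le_const[OF this, of "\<Sum>n<K. a n"] bound show ?thesis by auto
  qed
  then show ?thesis
    unfolding a_def[symmetric] by (rule summableI_nonneg_bounded[OF a01(1)])
qed

lemma AE_not_avoid: "AE w in P x. \<exists>n. \<not> avoid m n w"
proof -
  interpret P: prob_space "P x" by (rule prob_space[OF x])
  let ?A = "{w \<in> space (P x). \<forall>n. avoid m n w}"
  have A: "?A \<in> sets (P x)" using sets_avoid by (rule sets.sets_Collect_countable_All)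
  have "measure (P x) ?A \<le> 0"
  proof (rule LIMSEQ_le_const[OF summable_LIMSEQ_zero[OF summable_avoid[of m]]], intro exI allI impI)
    show "measure (P x) ?A \<le> \<P>(w in P x. avoid m n w)" for n
      by (rule P.finite_measure_mono[OF _ sets_avoid]) auto
  qed
  then have "measure (P x) ?A = 0" by (simp add: order_antisym)
  then have "?A \<in> null_sets (P x)" using A by (auto simp: P.emeasure_eq_measure)
  then show ?thesis by (rule AE_I') auto
qed

lemma recurrent_state_of_drift: "recurrent_state P Q x"
proof -
  have "AE w in P x. \<forall>m. \<exists>n. \<not> avoid m n w"
    using AE_not_avoid by (simp add: AE_all_countable)
  then show ?thesis unfolding recurrent_state_def
  proof eventually_elim
    case (elim w)
    show ?case
    proof
      assume "bounded {t. 0 \<le> t \<and> Q t w = x}"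
      then obtain B where B: "\<And>t. 0 \<le> t \<Longrightarrow> Q t w = x \<Longrightarrow> \<bar>t\<bar> \<le> B"
        unfolding bounded_iff by auto
      obtain m :: nat where m: "B < real m" using reals_Archimedean2 by blast
      obtain n where "\<not> avoid m n w" using elim by blast
      then obtain j where "m \<le> j" "Q (real (Suc j)) w = x" by (auto simp: avoids_step_def)
      then show False using B[of "real (Suc j)"] m by simp
    qed
  qed
qed

text \<open>
  The sum counts the integer times before the step from \<open>z\<close> to \<open>x\<close> is completed.  At its completion the
  chain is in \<open>x\<close>, and it has been in \<open>z \<noteq> x\<close> before, so that the first jump is over.
\<close>

lemma return_time_le_sum_avoid:
  assumes "Q 0 w = x"
  shows "return_time Q x w \<le> (\<Sum>n. of_bool (avoid 0 n w))"
proof (cases "\<exists>n. \<not> avoid 0 n w")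
  case True
  define n where "n = (LEAST n. \<not> avoid 0 n w)"
  have n: "\<not> avoid 0 n w" using LeastI_ex[OF True] by (simp add: n_def)
  have before: "avoid 0 k w" if "k < n" for k
    using not_less_Least[of k "\<lambda>n. \<not> avoid 0 n w"] that by (simp add: n_def)
  obtain j where j: "j < n" "Q (real j) w = z" "Q (real (Suc j)) w = x"
    using n by (auto simp: avoids_step_def)
  then have "\<not> avoid 0 (Suc j) w" by (auto simp: avoids_step_def)
  then have nj: "n = Suc j" using before[of "Suc j"] j(1) by (cases "Suc j < n") auto
  have "first_jump_time Q w \<le> ennreal (real j)"
    unfolding first_jump_time_def by (rule INF_lower) (use j assms xz in auto)
  also have "\<dots> \<le> ennreal (real (Suc j))" by (simp add: ennreal_leI)
  finally have "return_time Q x w \<le> ennreal (real (Suc j))"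
    unfolding return_time_def by (intro INF_lower) (use j in auto)
  also have "\<dots> = (\<Sum>k<n. of_bool (avoid 0 k w))"
    using before by (simp add: nj ennreal_of_nat_eq_real_of_nat)
  also have "\<dots> \<le> (\<Sum>n. of_bool (avoid 0 n w))" by (rule sum_le_suminf) auto
  finally show ?thesis .
next
  case False
  then have "(\<Sum>n. of_bool (avoid 0 n w) :: ennreal) = (\<Sum>n. 1)" by simp
  also have "\<dots> = top"
    using summable_suminf_not_top[of "\<lambda>_. 1"] by (auto simp: summable_const_iff)
  finally show ?thesis by simp
qed

lemma positive_recurrence_criterion: "positive_recurrent_state P Q x"
  unfolding positive_recurrent_state_def
proof
  interpret P: prob_space "P x" by (rule prob_space[OF x])
  show "recurrent_state P Q x" by (rule recurrent_state_of_drift)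
  have "(\<integral>\<^sup>+w. return_time Q x w \<partial>P x)
      \<le> (\<integral>\<^sup>+w. (\<Sum>n. indicator {w \<in> space (P x). avoid 0 n w} w) \<partial>P x)"
  proof (rule nn_integral_mono_AE)
    show "AE w in P x. return_time Q x w \<le> (\<Sum>n. indicator {w \<in> space (P x). avoid 0 n w} w)"
      using start[OF x] AE_space
    proof eventually_elim
      case (elim w)
      then have "(\<lambda>n. indicator {w \<in> space (P x). avoid 0 n w} w) = (\<lambda>n. of_bool (avoid 0 n w) :: ennreal)"
        by (auto simp: indicator_def)
      then show ?case using return_time_le_sum_avoid[OF elim(1)] by simp
    qed
  qed
  also have "\<dots> = (\<Sum>n. emeasure (P x) {w \<in> space (P x). avoid 0 n w})"
    using sets_avoid by (subst nn_integral_suminf) auto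
  also have "\<dots> = (\<Sum>n. ennreal \<P>(w in P x. avoid 0 n w))"
    by (simp add: P.emeasure_eq_measure)
  also have "\<dots> < \<infinity>"
    using summable_avoid[of 0] by (simp add: ennreal_suminf_neq_top less_top[symmetric])
  finally show "(\<integral>\<^sup>+w. return_time Q x w \<partial>P x) < \<infinity>" .
qed

end

end

section \<open>Drift of the interference-coupled queues\<close>

lemma path_loss_nonneg:
  assumes "path_loss l"
  shows "0 \<le> l r"
  using assms by (auto simp: path_loss_def ell1_def ell2_def ell3_def)

lemma sum_fun_upd:
  fixes g :: "'b \<Rightarrow> real"
  assumes "finite A" "i \<in> A"
  shows "(\<Sum>j\<in>A. g ((q(i := v)) j)) = (\<Sum>j\<in>A. g (q j)) - g (q i) + g v"
proof -
  have "(\<Sum>j\<in>A - {i}. g ((q(i := v)) j)) = (\<Sum>j\<in>A - {i}. g (q j))"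
    by (rule sum.cong) auto
  then show ?thesis by (simp add: sum.remove[OF assms])
qed

locale interference_queues =
  fixes N :: nat and B lam :: real and l :: "real \<Rightarrow> real"
  assumes N_pos: "0 < N" and B_pos: "0 < B" and lam_pos: "0 < lam" and l_nonneg: "\<And>r. 0 \<le> l r"
begin

abbreviation \<mu> :: "(nat \<Rightarrow> nat) \<Rightarrow> nat \<Rightarrow> real" where "\<mu> \<equiv> service_rate N B l"
abbreviation \<mu>s :: real where "\<mu>s \<equiv> mu_star N B l"
abbreviation gen :: "((nat \<Rightarrow> nat) \<Rightarrow> real) \<Rightarrow> (nat \<Rightarrow> nat) \<Rightarrow> real" where
  "gen \<equiv> queue_generator N B l lam"

lemma xi_nonneg: "0 \<le> xi N l"
  unfolding xi_def by (intro sum_nonneg l_nonneg)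

lemma mu_star_pos: "0 < \<mu>s"
  unfolding mu_star_def using xi_nonneg B_pos by (simp add: add_nonneg_pos)

lemma service_rate_ge:
  assumes "i \<in> {1..N}"
  shows "\<mu>s \<le> \<mu> q i"
proof -
  let ?s = "\<Sum>j\<in>{1..N} - {i}. of_bool (q j > 0) * l (torus_dist N i j)"
  have s: "0 \<le> ?s" by (intro sum_nonneg mult_nonneg_nonneg l_nonneg) auto
  have "?s \<le> (\<Sum>j\<in>{1..N} - {i}. l (torus_dist N i j))"
    by (intro sum_mono) (auto simp: l_nonneg)
  also have "\<dots> = xi N l" by (rule xi_eq[OF assms])
  finally have "1 / (1 + xi N l) \<le> 1 / (1 + ?s)" using s by (intro divide_left_mono) auto
  then have "log 2 (1 + 1 / (1 + xi N l)) \<le> log 2 (1 + 1 / (1 + ?s))"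
    using xi_nonneg s by (subst log_le_cancel_iff) (auto simp: add_pos_nonneg)
  then show ?thesis unfolding mu_star_def service_rate_def using B_pos by (simp add: mult_left_mono)
qed

lemma service_rate_pos: "i \<in> {1..N} \<Longrightarrow> 0 < \<mu> q i"
  using service_rate_ge[of i q] mu_star_pos by simp

lemma service_rate_le: "\<mu> q i \<le> B"
proof -
  let ?s = "\<Sum>j\<in>{1..N} - {i}. of_bool (q j > 0) * l (torus_dist N i j)"
  have s: "0 \<le> ?s" by (intro sum_nonneg mult_nonneg_nonneg l_nonneg) auto
  then have "log 2 (1 + 1 / (1 + ?s)) \<le> log 2 2"
    by (subst log_le_cancel_iff) (auto simp: add_pos_nonneg)
  then show ?thesis unfolding service_rate_def using B_pos mult_left_mono[of _ 1 B] by simp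
qed

lemma service_rate_all_busy:
  assumes "i \<in> {1..N}" "\<And>j. j \<in> {1..N} \<Longrightarrow> q j > 0"
  shows "\<mu> q i = \<mu>s"
proof -
  have "(\<Sum>j\<in>{1..N} - {i}. of_bool (q j > 0) * l (torus_dist N i j))
      = (\<Sum>j\<in>{1..N} - {i}. l (torus_dist N i j))"
    using assms(2) by (intro sum.cong) auto
  also have "\<dots> = xi N l" by (rule xi_eq[OF assms(1)])
  finally show ?thesis by (simp add: service_rate_def mu_star_def)
qed

text \<open>
  The function \<open>t \<mapsto> min t c\<close> is concave: at its maximum nothing can increase, and below the level \<open>c\<close>
  the truncation only lowers the values at neighbours.
\<close>

lemma generator_min_le:
  "gen (\<lambda>q. min (f q) c) q \<le> (if c \<le> f q then 0 else gen f q)"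
proof (cases "c \<le> f q")
  case True
  have "(\<Sum>i\<in>{1..N}. min (f (q(i := q i + 1))) c - min (f q) c) \<le> 0"
    using True by (intro sum_nonpos) auto
  moreover have "0 \<le> (\<Sum>i\<in>{1..N}. \<mu> q i * (min (f q) c - min (f (q(i := q i - 1))) c) * of_bool (q i > 0))"
    using True by (intro sum_nonneg mult_nonneg_nonneg less_imp_le[OF service_rate_pos]) auto
  moreover note mult_nonneg_nonpos[OF less_imp_le[OF lam_pos] calculation(1)]
  ultimately show ?thesis using True unfolding queue_generator_def by simp
next
  case False
  have "(\<Sum>i\<in>{1..N}. min (f (q(i := q i + 1))) c - min (f q) c) \<le> (\<Sum>i\<in>{1..N}. f (q(i := q i + 1)) - f q)"
    using False by (intro sum_mono) auto
  moreover have "(\<Sum>i\<in>{1..N}. \<mu> q i * (f q - f (q(i := q i - 1))) * of_bool (q i > 0))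
      \<le> (\<Sum>i\<in>{1..N}. \<mu> q i * (min (f q) c - min (f (q(i := q i - 1))) c) * of_bool (q i > 0))"
    using False by (intro sum_mono mult_right_mono mult_left_mono less_imp_le[OF service_rate_pos]) auto
  ultimately show ?thesis using False lam_pos
    unfolding queue_generator_def by (auto intro!: diff_mono mult_left_mono)
qed

lemma exit_rate_le: "- gen (indicat_real {q}) q \<le> real N * (lam + B)"
proof -
  have "(\<Sum>i\<in>{1..N}. - 1) \<le> (\<Sum>i\<in>{1..N}. indicat_real {q} (q(i := q i + 1)) - indicat_real {q} q)"
    by (intro sum_mono) (auto simp: indicator_def)
  from mult_left_mono[OF this, of lam] lam_pos
  have 1: "- (lam * real N) \<le> lam * (\<Sum>i\<in>{1..N}. indicat_real {q} (q(i := q i + 1)) - indicat_real {q} q)"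
    by simp
  have "(\<Sum>i\<in>{1..N}. \<mu> q i * (indicat_real {q} q - indicat_real {q} (q(i := q i - 1))) * of_bool (q i > 0))
      \<le> (\<Sum>i\<in>{1..N}. B)"
    using service_rate_le B_pos less_imp_le[OF service_rate_pos] by (intro sum_mono) (auto simp: indicator_def)
  with 1 show ?thesis unfolding queue_generator_def by (simp add: algebra_simps)
qed

lemma generator_point_nonneg:
  assumes "q \<noteq> y"
  shows "0 \<le> (\<Sum>i\<in>{1..N}. indicat_real {y} (q(i := q i + 1)) - indicat_real {y} q)"
    and "(\<Sum>i\<in>{1..N}. \<mu> q i * (indicat_real {y} q - indicat_real {y} (q(i := q i - 1))) * of_bool (q i > 0)) \<le> 0"
  using assms less_imp_le[OF service_rate_pos]
  by (auto intro!: sum_nonneg sum_nonpos simp: indicator_def)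

lemma arrival_rate_pos:
  assumes i: "i \<in> {1..N}"
  shows "0 < gen (indicat_real {q(i := q i + 1)}) q"
proof -
  let ?y = "q(i := q i + 1)"
  have ne: "q \<noteq> ?y" by (metis fun_upd_same n_not_Suc_n Suc_eq_plus1)
  have "indicat_real {?y} ?y - indicat_real {?y} q
      \<le> (\<Sum>i\<in>{1..N}. indicat_real {?y} (q(i := q i + 1)) - indicat_real {?y} q)"
    by (rule member_le_sum[OF i, of "\<lambda>i. indicat_real {?y} (q(i := q i + 1)) - indicat_real {?y} q"])
       (use ne in \<open>auto simp: indicator_def\<close>)
  then have "1 \<le> (\<Sum>i\<in>{1..N}. indicat_real {?y} (q(i := q i + 1)) - indicat_real {?y} q)"
    using ne by (simp add: indicator_def)
  from mult_left_mono[OF this, of lam] generator_point_nonneg(2)[OF ne] lam_pos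
  show ?thesis unfolding queue_generator_def by linarith
qed

lemma departure_rate_pos:
  assumes i: "i \<in> {1..N}" and "0 < q i"
  shows "0 < gen (indicat_real {q(i := q i - 1)}) q"
proof -
  let ?y = "q(i := q i - 1)"
  let ?t = "\<lambda>j. \<mu> q j * (indicat_real {?y} (q(j := q j - 1)) - indicat_real {?y} q) * of_bool (q j > 0)"
  have ne: "q \<noteq> ?y" using \<open>0 < q i\<close> by (metis fun_upd_same diff_less zero_less_one less_irrefl)
  have "?t i \<le> sum ?t {1..N}"
    by (rule member_le_sum[OF i, of ?t])
       (use ne less_imp_le[OF service_rate_pos] in \<open>auto simp: indicator_def\<close>)
  moreover have "0 < ?t i" using ne assms service_rate_pos[OF i, of q] by (simp add: indicator_def)
  moreover have "(\<Sum>j\<in>{1..N}. \<mu> q j * (indicat_real {?y} q - indicat_real {?y} (q(j := q j - 1))) * of_bool (q j > 0))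
      = - sum ?t {1..N}"
    unfolding sum_negf[symmetric] by (rule sum.cong) (auto simp: algebra_simps)
  ultimately show ?thesis
    unfolding queue_generator_def
    using mult_nonneg_nonneg[OF less_imp_le[OF lam_pos] generator_point_nonneg(1)[OF ne]] by linarith
qed

lemma states_upd: "q \<in> states N \<Longrightarrow> i \<in> {1..N} \<Longrightarrow> q(i := v) \<in> states N"
  by (auto simp: states_def PiE_def extensional_def)

definition total :: "(nat \<Rightarrow> nat) \<Rightarrow> nat" where
  "total q = (\<Sum>i\<in>{1..N}. q i)"

definition empty_state :: "nat \<Rightarrow> nat" where
  "empty_state = restrict (\<lambda>_. 0) {1..N}"

lemma empty_state: "empty_state \<in> states N"
  by (auto simp: empty_state_def states_def)

lemma total_upd_less: "i \<in> {1..N} \<Longrightarrow> v < q i \<Longrightarrow> total (q(i := v)) < total q"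
  unfolding total_def by (rule sum_strict_mono_ex1) auto

lemma total_eq_0: "q \<in> states N \<Longrightarrow> total q = 0 \<Longrightarrow> q = empty_state"
  unfolding total_def empty_state_def states_def by (rule extensionalityI[of _ "{1..N}"]) (auto simp: PiE_def)

definition energy :: "(nat \<Rightarrow> nat) \<Rightarrow> real" where
  "energy q = (\<Sum>i\<in>{1..N}. (real (q i))\<^sup>2)"

text \<open>
  A nonempty queue of length \<open>k\<close> contributes \<open>\<lambda> (2 k + 1) - \<mu> (2 k - 1)\<close>, with \<open>\<mu>\<close> between \<open>\<mu>\<^sup>*\<close> and \<open>B\<close>;
  an empty one contributes \<open>\<lambda>\<close>.
\<close>

lemma generator_energy_le:
  "gen energy q \<le> 2 * (lam - \<mu>s) * real (total q) + real N * (lam + B)"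
proof -
  have up: "energy (q(i := q i + 1)) - energy q = 2 * real (q i) + 1" if "i \<in> {1..N}" for i
    unfolding energy_def using sum_fun_upd[of "{1..N}" i "\<lambda>v. (real v)\<^sup>2" q "q i + 1"] that
    by (simp add: power2_eq_square algebra_simps)
  have down: "energy q - energy (q(i := q i - 1)) = 2 * real (q i) - 1" if "i \<in> {1..N}" "0 < q i" for i
    unfolding energy_def using sum_fun_upd[of "{1..N}" i "\<lambda>v. (real v)\<^sup>2" q "q i - 1"] that
    by (simp add: power2_eq_square algebra_simps of_nat_diff)
  have "gen energy q = (\<Sum>i\<in>{1..N}. lam * (2 * real (q i) + 1)) - (\<Sum>i\<in>{1..N}. \<mu> q i * (2 * real (q i) - 1) * of_bool (q i > 0))"
    unfolding queue_generator_def sum_distrib_left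
    by (intro arg_cong2[of _ _ _ _ "(-)"] sum.cong refl) (use up down in auto)
  also have "\<dots> = (\<Sum>i\<in>{1..N}. lam * (2 * real (q i) + 1) - \<mu> q i * (2 * real (q i) - 1) * of_bool (q i > 0))"
    by (simp add: sum_subtractf)
  also have "\<dots> \<le> (\<Sum>i\<in>{1..N}. 2 * (lam - \<mu>s) * real (q i) + (lam + B))"
  proof (rule sum_mono)
    fix i assume i: "i \<in> {1..N}"
    show "lam * (2 * real (q i) + 1) - \<mu> q i * (2 * real (q i) - 1) * of_bool (q i > 0)
        \<le> 2 * (lam - \<mu>s) * real (q i) + (lam + B)"
    proof (cases "q i = 0")
      case False
      have "\<mu>s * real (q i) \<le> \<mu> q i * real (q i)"
        using service_rate_ge[OF i] by (simp add: mult_right_mono)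
      moreover have "lam * (2 * real (q i) + 1) - \<mu> q i * (2 * real (q i) - 1)
          = 2 * (lam * real (q i)) + lam - 2 * (\<mu> q i * real (q i)) + \<mu> q i"
        by (simp add: algebra_simps)
      moreover have "2 * (lam - \<mu>s) * real (q i) = 2 * (lam * real (q i)) - 2 * (\<mu>s * real (q i))"
        by (simp add: algebra_simps)
      ultimately have "lam * (2 * real (q i) + 1) - \<mu> q i * (2 * real (q i) - 1)
          \<le> 2 * (lam - \<mu>s) * real (q i) + (lam + B)"
        using service_rate_le[of q i] by linarith
      then show ?thesis using False by simp
    qed (use B_pos in simp)
  qed
  also have "\<dots> = 2 * (lam - \<mu>s) * real (total q) + real N * (lam + B)"
    by (simp add: total_def sum.distrib sum_distrib_left)
  finally show ?thesis .
qed

lemma finite_total_le: "finite {q \<in> states N. total q \<le> R}"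
proof (rule finite_subset)
  show "{q \<in> states N. total q \<le> R} \<subseteq> {1..N} \<rightarrow>\<^sub>E {..R}"
  proof
    fix q assume q: "q \<in> {q \<in> states N. total q \<le> R}"
    have "q i \<le> R" if "i \<in> {1..N}" for i
      using member_le_sum[of i "{1..N}" q] that q by (auto simp: total_def)
    with q show "q \<in> {1..N} \<rightarrow>\<^sub>E {..R}" by (auto simp: states_def)
  qed
qed (auto intro: finite_PiE)

text \<open>
  A sum below \<open>1\<close> excludes empty queues, since each of them would contribute \<open>\<theta> ^ 0 = 1\<close>.  So all rates equal
  \<open>\<mu>\<^sup>*\<close>, and each queue contributes a positive multiple of \<open>(\<theta> - 1) (\<lambda> \<theta> - \<mu>\<^sup>*)\<close>.
\<close>

lemma generator_geometric_neg:
  fixes \<theta> :: real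
  assumes \<theta>: "0 < \<theta>" "\<theta> < 1" "\<mu>s < lam * \<theta>" and lt1: "(\<Sum>i\<in>{1..N}. \<theta> ^ q i) < 1"
  shows "gen (\<lambda>q. \<Sum>i\<in>{1..N}. \<theta> ^ q i) q < 0"
proof -
  let ?f = "\<lambda>q :: nat \<Rightarrow> nat. \<Sum>i\<in>{1..N}. \<theta> ^ q i"
  have busy: "0 < q i" if "i \<in> {1..N}" for i
  proof (rule ccontr)
    assume "\<not> 0 < q i"
    then have "1 \<le> ?f q" using member_le_sum[of i "{1..N}" "\<lambda>i. \<theta> ^ q i"] that \<theta> by simp
    with lt1 show False by simp
  qed
  have up: "?f (q(i := q i + 1)) - ?f q = \<theta> ^ (q i + 1) - \<theta> ^ q i" if "i \<in> {1..N}" for i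
    using sum_fun_upd[of "{1..N}" i "\<lambda>v. \<theta> ^ v" q "q i + 1"] that by simp
  have down: "?f q - ?f (q(i := q i - 1)) = \<theta> ^ q i - \<theta> ^ (q i - 1)" if "i \<in> {1..N}" for i
    using sum_fun_upd[of "{1..N}" i "\<lambda>v. \<theta> ^ v" q "q i - 1"] that by simp
  have "gen ?f q = (\<Sum>i\<in>{1..N}. lam * (\<theta> ^ (q i + 1) - \<theta> ^ q i)) - (\<Sum>i\<in>{1..N}. \<mu>s * (\<theta> ^ q i - \<theta> ^ (q i - 1)))"
    unfolding queue_generator_def sum_distrib_left
    by (intro arg_cong2[of _ _ _ _ "(-)"] sum.cong refl)
       (use up down service_rate_all_busy busy in simp_all)
  also have "\<dots> = (\<Sum>i\<in>{1..N}. lam * (\<theta> ^ (q i + 1) - \<theta> ^ q i) - \<mu>s * (\<theta> ^ q i - \<theta> ^ (q i - 1)))"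
    by (simp add: sum_subtractf)
  also have "\<dots> = (\<Sum>i\<in>{1..N}. - (\<theta> ^ (q i - 1) * ((1 - \<theta>) * (lam * \<theta> - \<mu>s))))"
  proof (rule sum.cong[OF refl])
    fix i assume "i \<in> {1..N}"
    then obtain p where "q i = Suc p" using busy[of i] by (cases "q i") auto
    then show "lam * (\<theta> ^ (q i + 1) - \<theta> ^ q i) - \<mu>s * (\<theta> ^ q i - \<theta> ^ (q i - 1))
        = - (\<theta> ^ (q i - 1) * ((1 - \<theta>) * (lam * \<theta> - \<mu>s)))"
      by (simp add: algebra_simps)
  qed
  also have "\<dots> < 0"
    unfolding sum_negf using \<theta> N_pos by (simp, intro sum_pos mult_pos_pos) auto
  finally show ?thesis .
qed

end

section \<open>The queueing chain\<close>

locale interference_queue_chain = interference_queues N B lam l +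
  ctmc "states N" "queue_generator N B l lam" P Q
  for N B lam l and P :: "(nat \<Rightarrow> nat) \<Rightarrow> 'w measure" and Q
begin

sublocale bounded_rate_ctmc "states N" "queue_generator N B l lam" P Q "real N * (lam + B) + 1"
  by unfold_locales (use exit_rate_le in \<open>simp add: less_eq_real_def order_le_less_trans[OF _ less_add_one]\<close>)

text \<open>
  Irreducibility: single departures lead from any state to the empty one, and the corresponding
  arrivals lead back.
\<close>

lemma reaches_empty_state: "q \<in> states N \<Longrightarrow> reaches q empty_state \<and> reaches empty_state q"
proof (induction "total q" arbitrary: q rule: less_induct)
  case less
  show ?case
  proof (cases "total q = 0")
    case True
    then show ?thesis using total_eq_0 reaches_refl empty_state less.prems by metis
  next
    case False
    then obtain i where i: "i \<in> {1..N}" "0 < q i" by (auto simp: total_def)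
    let ?r = "q(i := q i - 1)"
    have r: "?r \<in> states N" by (rule states_upd[OF less.prems i(1)])
    have ne: "q \<noteq> ?r" using i by (metis fun_upd_same diff_less zero_less_one less_irrefl)
    have q: "q = ?r(i := ?r i + 1)" using i by auto
    have IH: "reaches ?r empty_state" "reaches empty_state ?r"
      using less.hyps[OF total_upd_less[OF i(1)] r] i(2) by auto
    have "reaches q ?r"
      by (rule reaches_of_rate_pos[OF less.prems r ne departure_rate_pos[of i q, OF i]])
    moreover have "reaches ?r q"
      by (rule reaches_of_rate_pos[OF r less.prems ne[symmetric]])
         (use arrival_rate_pos[OF i(1), of ?r] q in simp)
    ultimately show ?thesis
      using IH reaches_trans less.prems empty_state by blast
  qed
qed

lemma kernel_pos:
  assumes "x \<in> states N" "y \<in> states N" "t > 0"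
  shows "0 < pmf (kernel t x) y"
  using reaches_trans[OF assms(1), of empty_state y] reaches_empty_state assms
  by (auto simp: reaches_def)

lemma transient:
  assumes lam: "\<mu>s < lam"
  shows "transient_chain (states N) P Q"
  unfolding transient_chain_def
proof
  fix x assume x: "x \<in> states N"
  \<comment> \<open>the midpoint between \<open>\<mu>\<^sup>* / \<lambda>\<close> and \<open>1\<close>\<close>
  define \<theta> where "\<theta> = (\<mu>s / lam + 1) / 2"
  have \<theta>: "0 < \<theta>" "\<theta> < 1" "\<mu>s < lam * \<theta>"
    using lam lam_pos mu_star_pos by (auto simp: \<theta>_def field_simps add_pos_pos)
  define f where "f q = (\<Sum>i\<in>{1..N}. \<theta> ^ q i)" for q :: "nat \<Rightarrow> nat"
  have f0: "0 \<le> f q" for q unfolding f_def using \<theta> by (intro sum_nonneg) auto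
  have neg: "gen f q < 0" if "f q < 1" for q
    using generator_geometric_neg[OF \<theta>] that unfolding f_def by blast
  obtain R where R: "\<theta> ^ R < 1 / real N"
    using real_arch_pow_inv[of "1 / real N" \<theta>] \<theta> N_pos by auto
  define z where "z = restrict (\<lambda>_. R) {1..N}"
  have z: "z \<in> states N" by (auto simp: z_def states_def)
  have "f z = real N * \<theta> ^ R" by (simp add: f_def z_def)
  then have fz: "f z < 1" using R N_pos by (simp add: field_simps)
  show "transient_state P Q x"
  proof (rule transience_criterion[OF x z])
    show "\<bar>min (f q) 1\<bar> \<le> 1" for q using f0[of q] by auto
    show "gen (\<lambda>q. min (f q) 1) q \<le> 0" for q
      using generator_min_le[of f 1 q] neg[of q] by (auto split: if_splits)
    show "gen (\<lambda>q. min (f q) 1) z < 0"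
      using generator_min_le[of f 1 z] neg[OF fz] fz by auto
    show "0 < pmf (kernel 1 x) z" by (rule kernel_pos[OF x z]) simp
  qed
qed

lemma positive_recurrent:
  assumes lam: "lam < \<mu>s"
  shows "positive_recurrent_chain (states N) P Q"
  unfolding positive_recurrent_chain_def
proof
  fix x assume x: "x \<in> states N"
  define b where "b = real N * (lam + B) + 1"
  have b: "0 \<le> b" using lam_pos B_pos by (simp add: b_def)
  define F where "F = {q \<in> states N. total q \<le> nat \<lceil>b / (2 * (\<mu>s - lam))\<rceil>}"
  have far: "gen energy q \<le> - 1" if "q \<in> states N" "q \<notin> F" for q
  proof -
    have "b / (2 * (\<mu>s - lam)) \<le> real (total q)"
      using that by (simp add: F_def) linarith
    then have "b \<le> 2 * (\<mu>s - lam) * real (total q)"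
      using lam by (simp add: field_simps)
    then show ?thesis using generator_energy_le[of q] by (simp add: b_def algebra_simps)
  qed
  have near: "gen energy q \<le> b - 1" for q
  proof -
    have "2 * (lam - \<mu>s) * real (total q) \<le> 0" using lam by (simp add: mult_nonpos_nonneg)
    then show ?thesis using generator_energy_le[of q] by (simp add: b_def)
  qed
  \<comment> \<open>any state other than \<open>x\<close> would do\<close>
  define z where "z = x(1 := x 1 + 1)"
  have z: "z \<in> states N" unfolding z_def by (rule states_upd[OF x]) (use N_pos in auto)
  have "x \<noteq> z" unfolding z_def by (metis fun_upd_same n_not_Suc_n Suc_eq_plus1)
  show "positive_recurrent_state P Q x"
  proof (rule positive_recurrence_criterion[where V = energy and F = F and b = b and z = z])
    show "0 \<le> energy q" for q unfolding energy_def by (intro sum_nonneg) auto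
    show "gen (\<lambda>q. min (energy q) M) q \<le> of_bool (M \<le> energy q) + b * of_bool (q \<in> F) - 1"
      if "q \<in> states N" for M q
      using generator_min_le[of energy M q] near[of q] far[OF that] b
      by (cases "M \<le> energy q"; cases "q \<in> F") auto
    show "finite F" unfolding F_def by (rule finite_total_le)
    show "0 < pmf (kernel 1 y) z" if "y \<in> F" for y
      by (rule kernel_pos[OF _ z]) (use that in \<open>auto simp: F_def\<close>)
    show "0 < pmf (kernel 1 z) x" by (rule kernel_pos[OF z x]) simp
  qed (use b x z \<open>x \<noteq> z\<close> in auto)
qed

end

theorem theorem3p1:
  fixes N :: nat and B lam :: real and l :: "real \<Rightarrow> real"
    and P :: "(nat \<Rightarrow> nat) \<Rightarrow> 'w measure"
    and Q :: "real \<Rightarrow> 'w \<Rightarrow> (nat \<Rightarrow> nat)"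
  assumes "N \<ge> 2" and "B > 0" and "lam > 0"
    and "path_loss l"
    and "ctmc (states N) (queue_generator N B l lam) P Q"
  shows "(lam > mu_star N B l \<longrightarrow> transient_chain (states N) P Q) \<and>
         (lam < mu_star N B l \<longrightarrow> positive_recurrent_chain (states N) P Q)"
proof -
  interpret ctmc "states N" "queue_generator N B l lam" P Q by fact
  interpret interference_queue_chain N B lam l P Q
    by unfold_locales (use assms path_loss_nonneg in auto)
  show ?thesis using transient positive_recurrent by blast
qed

end
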